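(* Let $t$ be a positive integer and let $\mu$ be a $t$-core partition. Let $u',v'$ be nonnegative integers, let $j_u,k_u$ ($1\le u\le u'$) and $j'_v,k'_v$ ($1\le v\le v'$) be nonnegative integers, and for every partition $\lambda$ put $$g(\lambda)=G_\lambda\prod_{u=1}^{u'}\Biggl(\sum_{\substack{\square\in\lambda\\ h_\square\equiv \pm j_u \pmod t}} h_\square^{2k_u}\Biggr)\prod_{v=1}^{v'}\Biggl(\sum_{\substack{\square\in\lambda\\ c_\square\equiv j'_v \pmod t}} c_\square^{k'_v}\Biggr),$$ where $h_\square\equiv\pm j_u\pmod t$ means $h_\square\equiv j_u$ or $h_\square\equiv -j_u\pmod t$. Then there exists $r\in\mathbb{N}$ such that $D_t^r g(\lambda)=0$ for every partition $\lambda$ whose $t$-core is $\mu$. Moreover, $$P(n)=\sum_{\substack{\lambda_{t\text{-core}}=\mu\\ |\lambda|-|\mu|=nt}} F_{\lambda/\mu}\, g(\lambda)$$ is a polynomial in $n$ (for nonnegative integers $n$).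
   Context: A partition $\lambda$ is identified with its Young diagram (row $i$ has $\lambda_i$ boxes, box $(i,j)$ in row $i$, column $j$). The content of box $(i,j)$ is $c_\square=j-i$; its hook length $h_\square$ is the number of boxes to its right in its row plus the number below it in its column plus one. $\mathcal H(\lambda)$ is the multiset of hook lengths. A partition is a $t$-core if none of its hook lengths is divisible by $t$. The 01-sequence $(z_i)_{i\in\mathbb Z}$ of $\lambda$: traverse the boundary of the Young diagram from the bottom (the infinite vertical ray below the first column) to the right (the infinite horizontal ray to the right of the first row), labelling vertical edges $0$ and horizontal edges $1$; the index is fixed by $\#\{i\ge 0: z_i=0\}=\#\{i<0:z_i=1\}$. Boxes of $\lambda$ correspond to pairs $i<j$ with $z_i=1,z_j=0$, the hook length being $j-i$. If $z_i=0,z_{i+t}=1$, exchanging these two values gives a new partition, said to be obtained from $\lambda$ by adding a $t$-hook (the reverse operation removes a $t$-hook). Write $\lambda\ge_t\mu$ if $\lambda$ is obtained from $\mu$ by adding a sequence of $t$-hooks. The $t$-core $\lambda_{t\text{-core}}$ of $\lambda$ is the partition obtained by removing $t$-hooks until none can be removed (independent of choices). $F_{\lambda/\mu}$ (for $\lambda\ge_t\mu$) is defined by $F_{\mu/\mu}=1$ and $F_{\lambda/\mu}=\sum F_{\lambda^-/\mu}$ over all $\lambda^-$ with $\lambda\ge_t\lambda^-\ge_t\mu$ and $|\lambda|-|\lambda^-|=t$. $G_\lambda=1/\prod_{h\in\mathcal H(\lambda),\ t\mid h}h$ (empty product $=1$). For a function $g$ on partitions, $D_tg(\lambda)=\sum_{\lambda^+}g(\lambda^+)-g(\lambda)$,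 the sum over all partitions $\lambda^+$ obtained from $\lambda$ by adding one $t$-hook; $D_t^0g=g$, $D_t^kg=D_t(D_t^{k-1}g)$. *)

theory Defs
  imports Complex_Main "HOL-Library.Multiset" "HOL-Number_Theory.Cong"
    "HOL-Computational_Algebra.Polynomial"
begin

text \<open>
  A partition is given by its row lengths \<open>part \<nu> 0 \<ge> part \<nu> 1 \<ge> \<dots>\<close>, continued by zeros.
  Rows and columns are numbered from 0; this affects neither contents nor hook lengths.
\<close>

typedef int_partition = "{f :: nat \<Rightarrow> nat. antimono f \<and> finite {i. f i \<noteq> 0}}"
  morphisms part Abs_int_partition
  by (rule exI[of _ "\<lambda>_. 0"]) (auto simp: antimono_def)

definition boxes :: "int_partition \<Rightarrow> (nat \<times> nat) set" where
  "boxes \<nu> = {(i, j). j < part \<nu> i}"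

definition psize :: "int_partition \<Rightarrow> nat" where
  "psize \<nu> = card (boxes \<nu>)"

definition box_content :: "nat \<times> nat \<Rightarrow> int" where
  "box_content b = int (snd b) - int (fst b)"

definition hook_length :: "int_partition \<Rightarrow> nat \<times> nat \<Rightarrow> nat" where
  "hook_length \<nu> b =
     card {j. snd b < j \<and> (fst b, j) \<in> boxes \<nu>} + card {i. fst b < i \<and> (i, snd b) \<in> boxes \<nu>} + 1"

definition hook_lengths :: "int_partition \<Rightarrow> nat multiset" where
  "hook_lengths \<nu> = image_mset (hook_length \<nu>) (mset_set (boxes \<nu>))"

definition is_core :: "nat \<Rightarrow> int_partition \<Rightarrow> bool" where
  "is_core t \<nu> \<longleftrightarrow> (\<forall>h \<in># hook_lengths \<nu>. \<not> t dvd h)"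

lemma finite_boxes: "finite (boxes \<nu>)"
proof -
  have "finite {i. part \<nu> i \<noteq> 0}"
    using part[of \<nu>] by simp
  then have "finite (Sigma {i. part \<nu> i \<noteq> 0} (\<lambda>i. {..<part \<nu> i}))"
    by blast
  moreover have "boxes \<nu> \<subseteq> Sigma {i. part \<nu> i \<noteq> 0} (\<lambda>i. {..<part \<nu> i})"
    by (auto simp: boxes_def)
  ultimately show ?thesis
    by (rule rev_finite_subset)
qed

text \<open>
  Let \<open>x\<close> be the column coordinate (to the right) and \<open>y\<close> the row coordinate (downwards) of the
  lattice points. Every step of the boundary walk increases \<open>x\<close> or decreases \<open>y\<close> by 1, so
  indexing an edge by the value of \<open>x - y\<close> at its starting point numbers the edges
  consecutively. The vertical edge at the end of row \<open>i\<close> starts at \<open>(part \<nu> i, i + 1)\<close>.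
  Lemma \<open>zseq_normalized\<close> shows that this is the required choice of index.
\<close>

definition zseq :: "int_partition \<Rightarrow> int \<Rightarrow> nat" where
  "zseq \<nu> k = (if \<exists>i. k = int (part \<nu> i) - (int i + 1) then 0 else 1)"

lemma zseq_normalized:
  "finite {k. k \<ge> 0 \<and> zseq \<nu> k = 0}" "finite {k. k < 0 \<and> zseq \<nu> k = 1}"
  "card {k. k \<ge> 0 \<and> zseq \<nu> k = 0} = card {k. k < 0 \<and> zseq \<nu> k = 1}"
proof -
  define pos where "pos i = int (part \<nu> i) - (int i + 1)" for i
  have anti: "part \<nu> j \<le> part \<nu> i" if "i \<le> j" for i j
    using part[of \<nu>] that by (simp add: antimono_def)
  have "finite {i. part \<nu> i \<noteq> 0}"
    using part[of \<nu>] by simp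
  then obtain N where "\<forall>i \<in> {i. part \<nu> i \<noteq> 0}. i < N"
    using finite_nat_set_iff_bounded by blast
  then have N: "part \<nu> i = 0" if "i \<ge> N" for i
    using that by (metis (mono_tags) leD mem_Collect_eq)
  have inj: "inj_on pos S" for S
  proof (rule inj_onI)
    fix i j assume "pos i = pos j"
    then show "i = j"
      using anti[of i j] anti[of j i] by (cases "i \<le> j") (auto simp: pos_def)
  qed
  let ?R = "{i. i < N \<and> i < part \<nu> i}" and ?S = "{i. i < N \<and> \<not> i < part \<nu> i}"
  have z0: "zseq \<nu> k = 0 \<longleftrightarrow> k \<in> range pos" for k
    by (auto simp: zseq_def pos_def)
  have z1: "zseq \<nu> k = 1 \<longleftrightarrow> k \<notin> range pos" for k
    by (auto simp: zseq_def pos_def)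
  have pos_nonneg: "pos i \<ge> 0 \<longleftrightarrow> i < part \<nu> i" for i
    by (auto simp: pos_def)
  have lt_N: "i < N" if "i < part \<nu> i" for i
    using N[of i] that by (cases "i < N") auto
  have A: "{k. k \<ge> 0 \<and> zseq \<nu> k = 0} = pos ` ?R"
  proof (intro set_eqI iffI)
    fix k assume k: "k \<in> {k. k \<ge> 0 \<and> zseq \<nu> k = 0}"
    then obtain i where i: "k = pos i" by (auto simp: z0)
    then have "i < part \<nu> i" using k pos_nonneg[of i] by simp
    then show "k \<in> pos ` ?R" using i lt_N[of i] by simp
  next
    fix k assume "k \<in> pos ` ?R"
    then obtain i where "k = pos i" "i < part \<nu> i" by auto
    then show "k \<in> {k. k \<ge> 0 \<and> zseq \<nu> k = 0}" using pos_nonneg[of i] by (simp add: z0)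
  qed
  have low: "k \<in> range pos" if "k < - int N" for k
  proof -
    have "part \<nu> (nat (- k - 1)) = 0"
      using that by (intro N) linarith
    then have "k = pos (nat (- k - 1))"
      using that by (simp add: pos_def)
    then show ?thesis by blast
  qed
  have ge: "pos i \<ge> - int N" if "i < N" for i
    using that by (auto simp: pos_def)
  have lt: "i < N" if "pos i \<ge> - int N" for i
    using that N[of i] by (cases "i < N") (auto simp: pos_def)
  have B: "{k. k < 0 \<and> zseq \<nu> k = 1} = {- int N..<0} - pos ` ?S"
  proof (intro set_eqI iffI)
    fix k assume "k \<in> {k. k < 0 \<and> zseq \<nu> k = 1}"
    then show "k \<in> {- int N..<0} - pos ` ?S"
      using low[of k] z1[of k] by force
  next
    fix k assume k: "k \<in> {- int N..<0} - pos ` ?S"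
    have "k \<notin> range pos"
    proof
      assume "k \<in> range pos"
      then obtain i where i: "k = pos i" by blast
      then have "i \<in> ?S"
        using k lt[of i] pos_nonneg[of i] by auto
      then show False using k i by blast
    qed
    then show "k \<in> {k. k < 0 \<and> zseq \<nu> k = 1}"
      using k z1 by auto
  qed
  have sub: "pos ` ?S \<subseteq> {- int N..<0}"
    using ge pos_nonneg by force
  have "card {- int N..<0} = N" by simp
  then have "card ({- int N..<0} - pos ` ?S) = N - card ?S"
    using sub by (subst card_Diff_subset) (auto simp: card_image[OF inj])
  moreover have "card ?R + card ?S = N"
  proof -
    have "card (?R \<union> ?S) = card ?R + card ?S"
      by (intro card_Un_disjoint) auto
    moreover have "?R \<union> ?S = {..<N}" by auto
    ultimately show ?thesis by simp
  qed
  ultimately show "card {k. k \<ge> 0 \<and> zseq \<nu> k = 0} = card {k. k < 0 \<and> zseq \<nu> k = 1}"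
    unfolding A B by (simp add: card_image[OF inj])
  show "finite {k. k \<ge> 0 \<and> zseq \<nu> k = 0}" unfolding A by simp
  show "finite {k. k < 0 \<and> zseq \<nu> k = 1}" unfolding B by simp
qed

text \<open>\<open>add_hook t \<nu> \<rho>\<close>: the partition \<open>\<rho>\<close> is obtained from \<open>\<nu>\<close> by adding one \<open>t\<close>-hook.\<close>

definition add_hook :: "nat \<Rightarrow> int_partition \<Rightarrow> int_partition \<Rightarrow> bool" where
  "add_hook t \<nu> \<rho> \<longleftrightarrow>
     (\<exists>i. zseq \<nu> i = 0 \<and> zseq \<nu> (i + int t) = 1 \<and>
          zseq \<rho> = (zseq \<nu>)(i := 1, i + int t := 0))"

definition hook_ge :: "nat \<Rightarrow> int_partition \<Rightarrow> int_partition \<Rightarrow> bool" where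
  "hook_ge t \<nu> \<mu> \<longleftrightarrow> (add_hook t)\<^sup>*\<^sup>* \<mu> \<nu>"

definition core_of :: "nat \<Rightarrow> int_partition \<Rightarrow> int_partition" where
  "core_of t \<nu> = (THE \<mu>. hook_ge t \<nu> \<mu> \<and> \<not> (\<exists>\<rho>. add_hook t \<rho> \<mu>))"

text \<open>
  \<open>F t \<nu> \<mu>\<close> is the number \<open>F\<close> of the skew shape \<open>\<nu>/\<mu>\<close>. The condition \<open>0 < t\<close> only serves
  termination. If \<open>\<nu> \<ge>\<^sub>t \<mu>\<close> fails, the sum is empty and the value is 0.
\<close>

function F :: "nat \<Rightarrow> int_partition \<Rightarrow> int_partition \<Rightarrow> nat" where
  "F t \<nu> \<mu> =
     (if \<nu> = \<mu> then 1
      else (\<Sum>\<rho> | 0 < t \<and> hook_ge t \<nu> \<rho> \<and> hook_ge t \<rho> \<mu> \<and> psize \<nu> = psize \<rho> + t. F t \<rho> \<mu>))"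
  by auto
termination
  by (relation "measure (\<lambda>(t, \<nu>, \<mu>). psize \<nu>)") auto

declare F.simps [simp del]

definition G :: "nat \<Rightarrow> int_partition \<Rightarrow> rat" where
  "G t \<nu> = 1 / (\<Prod>h \<in># filter_mset (\<lambda>h. t dvd h) (hook_lengths \<nu>). of_nat h)"

definition D :: "nat \<Rightarrow> (int_partition \<Rightarrow> rat) \<Rightarrow> int_partition \<Rightarrow> rat" where
  "D t g \<nu> = (\<Sum>\<rho> | add_hook t \<nu> \<rho>. g \<rho>) - g \<nu>"

end

theory Submission
  imports Defs
begin

text \<open>
  A partition is encoded by its set of beads, the positions of the zeros of its 01-sequence; adding a
  \<open>t\<close>-hook moves a bead from \<open>a\<close> to \<open>a + t\<close>. The weights \<open>G \<rho> / G \<nu>\<close> of the hooks that can be added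
  to \<open>\<nu>\<close> are Lagrange interpolation coefficients on the runners modulo \<open>t\<close>. Therefore the moments
  \<open>M\<^sub>r\<^sub>,\<^sub>m(\<nu>) = \<Sum>\<^sub>a (G \<rho>\<^sub>a / G \<nu>) a\<^sup>m\<close>, summed over the addable positions \<open>a \<equiv> r\<close>, satisfy
  \<open>M\<^sub>r\<^sub>,\<^sub>0 = 1 / t\<close>, \<open>M\<^sub>r\<^sub>,\<^sub>1\<close> is invariant under adding hooks, and the change of \<open>M\<^sub>r\<^sub>,\<^sub>m\<close> is a combination
  of terms \<open>M\<^sub>r\<^sub>,\<^sub>i a\<^sup>e\<close> with \<open>i + e \<le> m - 2\<close>. Filter the functions \<open>q\<close> accordingly: \<open>q\<close> has weight \<open>w\<close>
  if its change is a combination of terms \<open>f(\<nu>) c(a mod t) a\<^sup>m\<close> with \<open>f\<close> of weight at most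
  \<open>w - 2 - m\<close>. Such functions form an algebra, and \<open>D\<^sub>t (G q) = G q'\<close> with \<open>q'\<close> two steps lower,
  so that \<open>D\<^sub>t\<close> is nilpotent on \<open>G q\<close>. The hook and content sums of the theorem belong to this algebra.
  Finally the binomial formula \<open>P(n) = \<Sum>\<^sub>k (n choose k) D\<^sub>t\<^sup>k g(\<mu>)\<close> has only finitely many terms.
\<close>

section \<open>Beads and hooks\<close>

definition bead :: "int_partition \<Rightarrow> nat \<Rightarrow> int" where
  "bead \<nu> i = int (part \<nu> i) - int i - 1"

definition beads :: "int_partition \<Rightarrow> int set" where
  "beads \<nu> = range (bead \<nu>)"

lemma zseq_beads: "zseq \<nu> k = (if k \<in> beads \<nu> then 0 else 1)"
  unfolding zseq_def beads_def bead_def by (auto simp: image_iff)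

lemma part_antimono: "i \<le> j \<Longrightarrow> part \<nu> j \<le> part \<nu> i"
  using part[of \<nu>] by (simp add: antimono_def)

lemma part_eventually_0:
  obtains N where "\<And>i. i \<ge> N \<Longrightarrow> part \<nu> i = 0"
proof -
  have "finite {i. part \<nu> i \<noteq> 0}"
    using part[of \<nu>] by simp
  then obtain N where "\<forall>i \<in> {i. part \<nu> i \<noteq> 0}. i < N"
    using finite_nat_set_iff_bounded by blast
  then show ?thesis
    by (intro that[of N]) force
qed

lemma bead_strict: "i < j \<Longrightarrow> bead \<nu> j < bead \<nu> i"
  using part_antimono[of i j \<nu>] by (simp add: bead_def)

lemma bead_less_iff: "bead \<nu> j < bead \<nu> i \<longleftrightarrow> i < j"
  using bead_strict[of i j \<nu>] bead_strict[of j i \<nu>] by (cases i j rule: linorder_cases) auto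

lemma inj_bead: "inj (bead \<nu>)"
  by (rule injI) (metis bead_less_iff less_irrefl linorder_neq_iff)

lemma bead_ge: "bead \<nu> i \<ge> - int i - 1"
  by (simp add: bead_def)

lemma beads_bounded_above: "s \<in> beads \<nu> \<Longrightarrow> s \<le> bead \<nu> 0"
  unfolding beads_def using bead_less_iff[of \<nu> 0] by (force simp: not_less)

lemma beads_low:
  obtains N where "\<And>k. k \<le> N \<Longrightarrow> k \<in> beads \<nu>"
proof -
  obtain N where N: "\<And>i. i \<ge> N \<Longrightarrow> part \<nu> i = 0"
    using part_eventually_0 by blast
  have "k \<in> beads \<nu>" if "k \<le> - int N - 1" for k
  proof -
    have "bead \<nu> (nat (- k - 1)) = k"
      using that N[of "nat (- k - 1)"] by (simp add: bead_def)
    then show ?thesis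
      unfolding beads_def by (metis rangeI)
  qed
  then show ?thesis
    by (rule that)
qed

lemma finite_beads_ge: "finite {s \<in> beads \<nu>. b \<le> s}"
  by (rule finite_subset[of _ "{b..bead \<nu> 0}"]) (auto dest: beads_bounded_above)

text \<open>Beads decrease strictly with the row, so the index of a bead can be read off from the
  bead set alone. This is what makes the encoding by \<open>beads\<close> faithful.\<close>

lemma card_beads_above: "card {s \<in> beads \<nu>. bead \<nu> i < s} = i"
proof -
  have "{s \<in> beads \<nu>. bead \<nu> i < s} = bead \<nu> ` {..<i}"
    by (auto simp: beads_def bead_less_iff)
  then show ?thesis
    by (simp add: card_image inj_on_subset[OF inj_bead])
qed

lemma beads_inject: "beads \<nu> = beads \<rho> \<longleftrightarrow> \<nu> = \<rho>"
proof
  assume eq: "beads \<nu> = beads \<rho>"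
  have "part \<nu> i = part \<rho> i" for i
  proof -
    have "bead \<nu> i \<in> beads \<rho>"
      using eq by (auto simp: beads_def)
    then obtain j where j: "bead \<nu> i = bead \<rho> j"
      by (auto simp: beads_def)
    then have "j = i"
      using card_beads_above[of \<nu> i] card_beads_above[of \<rho> j] eq by simp
    then show ?thesis
      using j by (simp add: bead_def)
  qed
  then show "\<nu> = \<rho>"
    by (simp add: part_inject[symmetric] fun_eq_iff)
qed simp

text \<open>Refines \<open>add_hook\<close> by keeping track of the bead that moves; all later
  differences are functions of this position.\<close>

definition hook_at :: "nat \<Rightarrow> int_partition \<Rightarrow> int \<Rightarrow> int_partition \<Rightarrow> bool" where
  "hook_at t \<nu> a \<rho> \<longleftrightarrow>
     a \<in> beads \<nu> \<and> a + int t \<notin> beads \<nu> \<and> beads \<rho> = insert (a + int t) (beads \<nu> - {a})"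

lemma add_hook_iff: "add_hook t \<nu> \<rho> \<longleftrightarrow> (\<exists>a. hook_at t \<nu> a \<rho>)"
proof -
  have "zseq \<rho> = (zseq \<nu>)(i := 1, i + int t := 0) \<longleftrightarrow> beads \<rho> = insert (i + int t) (beads \<nu> - {i})"
    for i
  proof
    assume "zseq \<rho> = (zseq \<nu>)(i := 1, i + int t := 0)"
    then have "zseq \<rho> k = 0 \<longleftrightarrow> ((zseq \<nu>)(i := 1, i + int t := 0)) k = 0" for k
      by simp
    note eq = this
    have "k \<in> beads \<rho> \<longleftrightarrow> k \<in> insert (i + int t) (beads \<nu> - {i})" for k
      using eq[of k] by (simp add: zseq_beads fun_upd_apply split: if_splits)
    then show "beads \<rho> = insert (i + int t) (beads \<nu> - {i})"
      by blast
  next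
    assume "beads \<rho> = insert (i + int t) (beads \<nu> - {i})"
    then show "zseq \<rho> = (zseq \<nu>)(i := 1, i + int t := 0)"
      by (intro ext) (simp add: zseq_beads fun_upd_apply)
  qed
  then show ?thesis
    unfolding add_hook_def hook_at_def by (auto simp: zseq_beads)
qed

lemma hook_at_unique: "hook_at t \<nu> a \<rho> \<Longrightarrow> hook_at t \<nu> a \<rho>' \<Longrightarrow> \<rho> = \<rho>'"
  by (simp add: hook_at_def flip: beads_inject)

lemma hook_at_unique_pos: "hook_at t \<nu> a \<rho> \<Longrightarrow> hook_at t \<nu> a' \<rho> \<Longrightarrow> a = a'"
  by (cases "t = 0") (auto simp: hook_at_def set_eq_iff)

section \<open>Partitions obtained by moving a bead\<close>

lemma part_Abs:
  assumes "antimono f" "finite {i. f i \<noteq> 0}"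
  shows "part (Abs_int_partition f) = f"
  using assms by (simp add: Abs_int_partition_inverse)

lemma finite_part_support: "finite {i. part \<nu> i \<noteq> 0}"
  using part[of \<nu>] by simp

lemma beads_upd:
  assumes "\<And>l. l \<noteq> i \<Longrightarrow> part \<rho> l = part \<nu> l"
  shows "beads \<rho> = insert (bead \<rho> i) (beads \<nu> - {bead \<nu> i})"
proof -
  have "beads \<rho> = insert (bead \<rho> i) (bead \<rho> ` (UNIV - {i}))"
    unfolding beads_def by blast
  also have "bead \<rho> ` (UNIV - {i}) = bead \<nu> ` (UNIV - {i})"
    by (rule image_cong) (auto simp: bead_def assms)
  also have "\<dots> = beads \<nu> - {bead \<nu> i}"
    using inj_bead[of \<nu>] by (auto simp: beads_def inj_eq)
  finally show ?thesis .
qed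

text \<open>An empty position \<open>a + 1\<close> means that the row of the bead \<open>a\<close>
  is strictly shorter than every row above it, so it can be lengthened by one box.\<close>

lemma ex_add_box:
  assumes "a \<in> beads \<nu>" "a + 1 \<notin> beads \<nu>"
  shows "\<exists>\<rho>. beads \<rho> = insert (a + 1) (beads \<nu> - {a})"
proof -
  obtain i where i: "a = bead \<nu> i"
    using assms(1) by (auto simp: beads_def)
  define f where "f = (part \<nu>)(i := part \<nu> i + 1)"
  have less: "part \<nu> i < part \<nu> l" if "l < i" for l
  proof -
    have "bead \<nu> (i - 1) \<noteq> a + 1"
      using assms(2) unfolding beads_def by (metis rangeI)
    then have "part \<nu> i < part \<nu> (i - 1)"
      using that part_antimono[of "i - 1" i \<nu>] by (auto simp: bead_def i)
    also have "\<dots> \<le> part \<nu> l"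
      using that by (intro part_antimono) auto
    finally show ?thesis .
  qed
  have "f y \<le> f x" if "x \<le> y" for x y
    using part_antimono[of x y \<nu>] part_antimono[of i y \<nu>] less[of x] that
    by (auto simp: f_def)
  then have "antimono f"
    by (simp add: antimono_def)
  moreover have "finite {l. f l \<noteq> 0}"
    by (rule finite_subset[of _ "insert i {l. part \<nu> l \<noteq> 0}"])
      (use finite_part_support in \<open>auto simp: f_def\<close>)
  ultimately have pf: "part (Abs_int_partition f) = f"
    by (rule part_Abs)
  have "beads (Abs_int_partition f) = insert (bead (Abs_int_partition f) i) (beads \<nu> - {bead \<nu> i})"
    by (rule beads_upd) (unfold pf, simp add: f_def)
  moreover have "bead (Abs_int_partition f) i = a + 1"
    unfolding bead_def pf by (simp add: f_def i bead_def)
  ultimately show ?thesis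
    using i by auto
qed

lemma ex_remove_box:
  assumes "a \<notin> beads \<nu>" "a + 1 \<in> beads \<nu>"
  shows "\<exists>\<rho>. beads \<rho> = insert a (beads \<nu> - {a + 1})"
proof -
  obtain i where i: "a + 1 = bead \<nu> i"
    using assms(2) by (auto simp: beads_def)
  define f where "f = (part \<nu>)(i := part \<nu> i - 1)"
  have "bead \<nu> (Suc i) \<noteq> a"
    using assms(1) unfolding beads_def by (metis rangeI)
  then have less: "part \<nu> (Suc i) < part \<nu> i"
    using i part_antimono[of i "Suc i" \<nu>] by (auto simp: bead_def)
  have less: "part \<nu> l < part \<nu> i" if "i < l" for l
    using less part_antimono[of "Suc i" l \<nu>] that by simp
  have "f y \<le> f x" if "x \<le> y" for x y
    using part_antimono[of x y \<nu>] part_antimono[of i y \<nu>] less[of y] that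
    by (auto simp: f_def)
  then have "antimono f"
    by (simp add: antimono_def)
  moreover have "finite {l. f l \<noteq> 0}"
    by (rule finite_subset[of _ "insert i {l. part \<nu> l \<noteq> 0}"])
      (use finite_part_support in \<open>auto simp: f_def\<close>)
  ultimately have pf: "part (Abs_int_partition f) = f"
    by (rule part_Abs)
  have "beads (Abs_int_partition f) = insert (bead (Abs_int_partition f) i) (beads \<nu> - {bead \<nu> i})"
    by (rule beads_upd) (unfold pf, simp add: f_def)
  moreover have "bead (Abs_int_partition f) i = a"
    using less[of "Suc i"] i unfolding bead_def pf by (simp add: f_def)
  ultimately show ?thesis
    using i by auto
qed

text \<open>A long move is composed of single-box moves, by induction on the distance. The position
  \<open>c\<close> just before the target decides the order: if it is occupied, its bead is pushed
  to the target and the bead \<open>a\<close> takes its place; if it is empty, the bead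
  \<open>a\<close> goes there first.\<close>

lemma ex_hook_at:
  assumes "0 < t" "a \<in> beads \<nu>" "a + int t \<notin> beads \<nu>"
  shows "\<exists>\<rho>. hook_at t \<nu> a \<rho>"
proof -
  have "\<exists>\<rho>. beads \<rho> = insert (a + 1 + int n) (beads \<nu> - {a})"
    if "a \<in> beads \<nu>" "a + 1 + int n \<notin> beads \<nu>" for n \<nu>
    using that
  proof (induction n arbitrary: \<nu>)
    case 0
    then show ?case using ex_add_box[of a \<nu>] by simp
  next
    case (Suc n)
    define c where "c = a + 1 + int n"
    have c: "c + 1 \<notin> beads \<nu>" "a + 1 + int (Suc n) = c + 1" "a \<noteq> c"
      using Suc.prems by (simp_all add: c_def algebra_simps)
    show ?case
    proof (cases "c \<in> beads \<nu>")
      case True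
      obtain \<sigma> where \<sigma>: "beads \<sigma> = insert (c + 1) (beads \<nu> - {c})"
        using ex_add_box[OF True c(1)] by blast
      obtain \<rho> where "beads \<rho> = insert c (beads \<sigma> - {a})"
        using Suc.IH[of \<sigma>] Suc.prems(1) c \<sigma> unfolding c_def[symmetric] by auto
      then have "beads \<rho> = insert (c + 1) (beads \<nu> - {a})"
        using \<sigma> c True Suc.prems by auto
      then show ?thesis unfolding c(2) by blast
    next
      case False
      then obtain \<sigma> where \<sigma>: "beads \<sigma> = insert c (beads \<nu> - {a})"
        using Suc.IH[of \<nu>] Suc.prems(1) unfolding c_def[symmetric] by auto
      then obtain \<rho> where "beads \<rho> = insert (c + 1) (beads \<sigma> - {c})"
        using ex_add_box[of c \<sigma>] c by auto
      then have "beads \<rho> = insert (c + 1) (beads \<nu> - {a})"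
        using \<sigma> c False by auto
      then show ?thesis unfolding c(2) by blast
    qed
  qed
  \<comment> \<open>The induction writes the distance as \<open>1 + n\<close>, so a move by
    \<open>t\<close> is the case \<open>n = t - 1\<close>.\<close>
  from this[of \<nu> "t - 1"] show ?thesis
    using assms by (simp add: hook_at_def of_nat_diff)
qed

text \<open>The mirror image of \<open>ex_hook_at\<close>, with the two orders of the moves
  exchanged.\<close>

lemma ex_hook_at_remove:
  assumes "0 < t" "a \<notin> beads \<nu>" "a + int t \<in> beads \<nu>"
  shows "\<exists>\<rho>. hook_at t \<rho> a \<nu>"
proof -
  have "\<exists>\<rho>. beads \<rho> = insert a (beads \<nu> - {a + 1 + int n})"
    if "a \<notin> beads \<nu>" "a + 1 + int n \<in> beads \<nu>" for n \<nu>
    using that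
  proof (induction n arbitrary: \<nu>)
    case 0
    then show ?case using ex_remove_box[of a \<nu>] by simp
  next
    case (Suc n)
    define c where "c = a + 1 + int n"
    have c: "c + 1 \<in> beads \<nu>" "a + 1 + int (Suc n) = c + 1" "a \<noteq> c"
      using Suc.prems by (simp_all add: c_def algebra_simps)
    show ?case
    proof (cases "c \<in> beads \<nu>")
      case False
      obtain \<sigma> where \<sigma>: "beads \<sigma> = insert c (beads \<nu> - {c + 1})"
        using ex_remove_box[OF False c(1)] by blast
      obtain \<rho> where "beads \<rho> = insert a (beads \<sigma> - {c})"
        using Suc.IH[of \<sigma>] Suc.prems(1) c \<sigma> unfolding c_def[symmetric] by auto
      then have "beads \<rho> = insert a (beads \<nu> - {c + 1})"
        using \<sigma> c False Suc.prems by auto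
      then show ?thesis unfolding c(2) by blast
    next
      case True
      then obtain \<sigma> where \<sigma>: "beads \<sigma> = insert a (beads \<nu> - {c})"
        using Suc.IH[of \<nu>] Suc.prems(1) unfolding c_def[symmetric] by auto
      have "c \<notin> beads \<sigma>" "c + 1 \<in> beads \<sigma>"
        using \<sigma> c by auto
      then obtain \<rho> where "beads \<rho> = insert c (beads \<sigma> - {c + 1})"
        using ex_remove_box[of c \<sigma>] by auto
      then have "beads \<rho> = insert a (beads \<nu> - {c + 1})"
        using \<sigma> c True Suc.prems by (auto simp: c_def)
      then show ?thesis unfolding c(2) by blast
    qed
  qed
  from this[of \<nu> "t - 1"] obtain \<rho> where "beads \<rho> = insert a (beads \<nu> - {a + int t})"
    using assms by (auto simp: of_nat_diff)
  then have "hook_at t \<rho> a \<nu>"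
    using assms by (auto simp: hook_at_def)
  then show ?thesis ..
qed

section \<open>Boxes as pairs of a gap and a bead\<close>

definition col :: "int_partition \<Rightarrow> nat \<Rightarrow> nat" where
  "col \<nu> j = card {i. j < part \<nu> i}"

text \<open>Conjugation: the rows longer than \<open>j\<close> form an initial segment, whose length
  is the column length.\<close>

lemma less_part_iff: "j < part \<nu> i \<longleftrightarrow> i < col \<nu> j"
proof -
  obtain N where N: "\<And>i. i \<ge> N \<Longrightarrow> part \<nu> i = 0"
    using part_eventually_0 by blast
  define n where "n = (LEAST i. part \<nu> i \<le> j)"
  have "part \<nu> n \<le> j"
    unfolding n_def by (rule LeastI[of _ N]) (simp add: N)
  moreover have "j < part \<nu> i" if "i < n" for i
    using not_less_Least[of i "\<lambda>i. part \<nu> i \<le> j"] that by (simp add: n_def)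
  ultimately have iff: "j < part \<nu> i \<longleftrightarrow> i < n" for i
    using part_antimono[of n i \<nu>] by (cases "i < n") auto
  then have "{i. j < part \<nu> i} = {..<n}"
    by auto
  then show ?thesis
    by (simp add: col_def iff)
qed

text \<open>The horizontal boundary edge below column \<open>j\<close> starts at the lattice point
  \<open>(j, col \<nu> j)\<close>; this is its index, hence the position of a one in the
  01-sequence.\<close>

definition gap :: "int_partition \<Rightarrow> nat \<Rightarrow> int" where
  "gap \<nu> j = int j - int (col \<nu> j)"

lemma gap_less_bead_iff: "gap \<nu> j < bead \<nu> i \<longleftrightarrow> j < part \<nu> i"
  using less_part_iff[of j \<nu> i] by (auto simp: gap_def bead_def)

lemma gap_notin_beads: "gap \<nu> j \<notin> beads \<nu>"
proof
  assume "gap \<nu> j \<in> beads \<nu>"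
  then obtain i where "gap \<nu> j = bead \<nu> i"
    by (auto simp: beads_def)
  then show False
    using less_part_iff[of j \<nu> i] by (auto simp: gap_def bead_def)
qed

lemma inj_gap: "inj (gap \<nu>)"
proof -
  have "gap \<nu> i < gap \<nu> j" if "i < j" for i j
  proof -
    have "col \<nu> j \<le> col \<nu> i"
      using less_part_iff[of j \<nu> "col \<nu> i"] less_part_iff[of i \<nu> "col \<nu> i"] that
      by linarith
    then show ?thesis
      using that by (simp add: gap_def)
  qed
  then have "strict_mono (gap \<nu>)"
    by (rule strict_monoI)
  then show ?thesis
    by (rule strict_mono_imp_inj_on)
qed

text \<open>If \<open>i\<close> beads lie above the empty position \<open>k\<close>, then column
  \<open>k + i\<close> has exactly \<open>i\<close> boxes, and its gap is \<open>k\<close>.\<close>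

lemma ex_gap:
  assumes "k \<notin> beads \<nu>"
  shows "\<exists>j. gap \<nu> j = k"
proof -
  define P where "P i \<longleftrightarrow> bead \<nu> i < k" for i
  define i where "i = (LEAST i. P i)"
  obtain N where "\<And>k. k \<le> N \<Longrightarrow> k \<in> beads \<nu>"
    using beads_low by blast
  then have "min N (k - 1) \<in> beads \<nu>"
    by simp
  then obtain l where "bead \<nu> l = min N (k - 1)"
    by (auto simp: beads_def)
  then have "P l"
    by (simp add: P_def)
  then have i: "bead \<nu> i < k"
    unfolding i_def by (metis LeastI P_def)
  have less: "k < bead \<nu> l" if "l < i" for l
  proof -
    have "\<not> bead \<nu> l < k"
      using not_less_Least[of l P] that by (auto simp: i_def P_def)
    moreover have "bead \<nu> l \<noteq> k"
      using assms by (auto simp: beads_def)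
    ultimately show ?thesis by simp
  qed
  define j where "j = nat (k + int i)"
  have j: "int j = k + int i"
    using i bead_ge[of i \<nu>] by (simp add: j_def)
  have "j < part \<nu> l \<longleftrightarrow> l < i" for l
  proof
    assume "j < part \<nu> l"
    show "l < i"
    proof (rule ccontr)
      assume "\<not> l < i"
      then have "j < part \<nu> i"
        using part_antimono[of i l \<nu>] \<open>j < part \<nu> l\<close> by simp
      then show False
        using i j by (simp add: bead_def)
    qed
  next
    assume "l < i"
    then have "k < bead \<nu> (i - 1)"
      by (intro less) auto
    then have "j < part \<nu> (i - 1)"
      using j \<open>l < i\<close> by (simp add: bead_def)
    then show "j < part \<nu> l"
      using part_antimono[of l "i - 1" \<nu>] \<open>l < i\<close> by linarith
  qed
  then have "{l. j < part \<nu> l} = {..<i}"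
    by auto
  then have "gap \<nu> j = k"
    using j by (simp add: gap_def col_def)
  then show ?thesis ..
qed

text \<open>The arm is \<open>part \<nu> i - j - 1\<close> and the leg
  \<open>col \<nu> j - i - 1\<close>; adding both and one gives the distance from the gap to the
  bead.\<close>

lemma hook_length_eq:
  assumes "j < part \<nu> i"
  shows "int (hook_length \<nu> (i, j)) = bead \<nu> i - gap \<nu> j"
proof -
  have "{j'. snd (i, j) < j' \<and> (fst (i, j), j') \<in> boxes \<nu>} = {j<..<part \<nu> i}"
    by (auto simp: boxes_def)
  moreover have "{i'. fst (i, j) < i' \<and> (i', snd (i, j)) \<in> boxes \<nu>} = {i<..<col \<nu> j}"
    by (auto simp: boxes_def less_part_iff)
  ultimately show ?thesis
    using assms less_part_iff[of j \<nu> i] by (simp add: hook_length_def bead_def gap_def of_nat_diff)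
qed

definition bead_pairs :: "int set \<Rightarrow> (int \<times> int) set" where
  "bead_pairs S = {(g, s). g \<notin> S \<and> s \<in> S \<and> g < s}"

lemma bij_betw_boxes:
  "bij_betw (\<lambda>(i, j). (gap \<nu> j, bead \<nu> i)) (boxes \<nu>) (bead_pairs (beads \<nu>))"
proof (rule bij_betw_imageI)
  show "inj_on (\<lambda>(i, j). (gap \<nu> j, bead \<nu> i)) (boxes \<nu>)"
    using inj_gap[of \<nu>] inj_bead[of \<nu>] by (auto simp: inj_on_def)
  show "(\<lambda>(i, j). (gap \<nu> j, bead \<nu> i)) ` boxes \<nu> = bead_pairs (beads \<nu>)"
  proof (intro equalityI subsetI)
    fix x assume "x \<in> (\<lambda>(i, j). (gap \<nu> j, bead \<nu> i)) ` boxes \<nu>"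
    then show "x \<in> bead_pairs (beads \<nu>)"
      using gap_notin_beads gap_less_bead_iff
      by (auto simp: bead_pairs_def boxes_def beads_def)
  next
    fix x assume x: "x \<in> bead_pairs (beads \<nu>)"
    then obtain g i where gi: "x = (g, bead \<nu> i)" "g \<notin> beads \<nu>" "g < bead \<nu> i"
      by (auto simp: bead_pairs_def beads_def)
    moreover obtain j where "gap \<nu> j = g"
      using ex_gap[OF gi(2)] by blast
    ultimately show "x \<in> (\<lambda>(i, j). (gap \<nu> j, bead \<nu> i)) ` boxes \<nu>"
      by (auto simp: boxes_def gap_less_bead_iff intro!: rev_image_eqI[of "(i, j)"])
  qed
qed

section \<open>Hooks and contents in terms of beads, for sums and products alike\<close>

context comm_monoid_set
begin

lemma hooks_eq_bead_pairs:
  "F (\<lambda>b. \<phi> (int (hook_length \<nu> b))) (boxes \<nu>) = F (\<lambda>(g, s). \<phi> (s - g)) (bead_pairs (beads \<nu>))"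
proof -
  have "F (\<lambda>b. \<phi> (int (hook_length \<nu> b))) (boxes \<nu>) =
      F (\<lambda>b. (case (case b of (i, j) \<Rightarrow> (gap \<nu> j, bead \<nu> i)) of (g, s) \<Rightarrow> \<phi> (s - g))) (boxes \<nu>)"
    by (rule cong) (auto simp: boxes_def hook_length_eq)
  also have "\<dots> = F (\<lambda>(g, s). \<phi> (s - g)) (bead_pairs (beads \<nu>))"
    by (rule reindex_bij_betw[OF bij_betw_boxes])
  finally show ?thesis .
qed

text \<open>For a bead \<open>s\<close> in the window, the positions in \<open>{b..<s}\<close> are
  gaps or beads. The gaps give the hooks ending at \<open>s\<close>, the beads give pairs inside the
  window, and together they realize each distance from 1 to \<open>s - b\<close> once. The bead
  pairs stand on the left because a monoid offers no subtraction.\<close>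

lemma bead_pairs_window:
  assumes low: "\<And>k. k < b \<Longrightarrow> k \<in> S" and fin: "finite {s \<in> S. b \<le> s}"
  shows "F (\<lambda>(g, s). \<phi> (s - g)) (bead_pairs S) \<^bold>*
           F (\<lambda>(g, s). \<phi> (s - g)) {(g, s). g \<in> {s \<in> S. b \<le> s} \<and> s \<in> {s \<in> S. b \<le> s} \<and> g < s} =
         F (\<lambda>s. F \<phi> {1..s - b}) {s \<in> S. b \<le> s}" (is "F ?h _ \<^bold>* F _ ?Q = F _ ?B")
proof -
  have eq: "Sigma ?B (\<lambda>s. {b..<s}) = prod.swap ` (bead_pairs S \<union> ?Q)"
  proof (intro set_eqI iffI)
    fix x assume "x \<in> Sigma ?B (\<lambda>s. {b..<s})"
    then show "x \<in> prod.swap ` (bead_pairs S \<union> ?Q)"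
      by (cases x) (auto simp: bead_pairs_def intro!: image_eqI[of _ _ "(snd x, fst x)"])
  next
    fix x assume "x \<in> prod.swap ` (bead_pairs S \<union> ?Q)"
    then obtain g s where x: "x = (s, g)" and "g < s" "s \<in> S" "g \<notin> S \<or> b \<le> g"
      by (auto simp: bead_pairs_def)
    moreover have "b \<le> g"
      using low[of g] calculation by force
    ultimately show "x \<in> Sigma ?B (\<lambda>s. {b..<s})"
      by auto
  qed
  have finS: "finite (Sigma ?B (\<lambda>s. {b..<s}))"
    using fin by (intro finite_SigmaI) auto
  then have "finite (bead_pairs S \<union> ?Q)"
    unfolding eq by (rule finite_imageD) simp
  then have "F ?h (bead_pairs S) \<^bold>* F ?h ?Q = F ?h (bead_pairs S \<union> ?Q)"
    by (intro union_disjoint[symmetric]) (auto simp: bead_pairs_def)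
  also have "\<dots> = F (\<lambda>(s, g). \<phi> (s - g)) (Sigma ?B (\<lambda>s. {b..<s}))"
    unfolding eq by (subst reindex) (auto simp: o_def split_def)
  also have "\<dots> = F (\<lambda>s. F (\<lambda>g. \<phi> (s - g)) {b..<s}) ?B"
    using fin by (subst Sigma) auto
  also have "\<dots> = F (\<lambda>s. F \<phi> {1..s - b}) ?B"
  proof (rule cong)
    fix s assume "s \<in> ?B"
    show "F (\<lambda>g. \<phi> (s - g)) {b..<s} = F \<phi> {1..s - b}"
      by (rule reindex_bij_witness[of _ "\<lambda>x. s - x" "\<lambda>g. s - g"]) auto
  qed simp
  finally show ?thesis .
qed

text \<open>Evenness allows the pairs containing \<open>a\<close> to be listed as
  \<open>a - l\<close>, whichever of \<open>a\<close> and \<open>l\<close> is larger.\<close>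

lemma pairs_insert:
  fixes a :: int
  assumes "finite B" "a \<notin> B" and even: "\<And>x. \<phi> (- x) = \<phi> x"
  shows "F (\<lambda>(g, s). \<phi> (s - g)) {(g, s). g \<in> insert a B \<and> s \<in> insert a B \<and> g < s} =
         F (\<lambda>(g, s). \<phi> (s - g)) {(g, s). g \<in> B \<and> s \<in> B \<and> g < s} \<^bold>* F (\<lambda>l. \<phi> (a - l)) B"
    (is "F ?h ?L = F ?h ?R \<^bold>* _")
proof -
  let ?N = "(\<lambda>l. (min a l, max a l)) ` B"
  have L: "?L = ?R \<union> ?N"
  proof (intro set_eqI iffI)
    fix x assume "x \<in> ?L"
    then obtain g s where x: "x = (g, s)" "g \<in> insert a B" "s \<in> insert a B" "g < s"
      by blast
    consider "g \<in> B" "s \<in> B" | "g = a" "s \<in> B" | "g \<in> B" "s = a"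
      using x by blast
    then show "x \<in> ?R \<union> ?N"
      by cases (use x in \<open>auto simp: min_def max_def intro: rev_image_eqI\<close>)
  next
    fix x assume "x \<in> ?R \<union> ?N"
    moreover have "(min a l, max a l) \<in> ?L" if "l \<in> B" for l
      using that assms(2) by (cases l a rule: linorder_cases) auto
    moreover have "?R \<subseteq> ?L"
      by auto
    ultimately show "x \<in> ?L"
      by (elim UnE imageE) (auto simp only:)
  qed
  have "finite ?R"
    by (rule finite_subset[of _ "B \<times> B"]) (use assms(1) in auto)
  then have "F ?h ?L = F ?h ?R \<^bold>* F ?h ?N"
    unfolding L using assms by (intro union_disjoint) (auto simp: min_def max_def split: if_splits)
  also have "F ?h ?N = F (\<lambda>l. \<phi> (a - l)) B"
  proof (subst reindex)
    show "inj_on (\<lambda>l. (min a l, max a l)) B"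
      by (auto simp: inj_on_def min_def max_def split: if_splits)
    show "F (?h \<circ> (\<lambda>l. (min a l, max a l))) B = F (\<lambda>l. \<phi> (a - l)) B"
      using even by (intro cong) (auto simp: min_def max_def, metis minus_diff_eq)
  qed
  finally show ?thesis .
qed

end

text \<open>Row \<open>i\<close> meets the diagonal of content \<open>c\<close> iff
  \<open>c \<le> bead \<nu> i\<close> and \<open>i + c \<ge> 0\<close>. For negative
  \<open>c\<close> the first \<open>- c\<close> rows satisfy the former condition but not the
  latter, whence the correction.\<close>

lemma card_boxes_content:
  "finite {b \<in> boxes \<nu>. box_content b = c}"
  "int (card {b \<in> boxes \<nu>. box_content b = c}) = int (card {s \<in> beads \<nu>. c \<le> s}) - max 0 (- c)"
proof -
  show "finite {b \<in> boxes \<nu>. box_content b = c}"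
    using finite_boxes by simp
  let ?I = "{i. c \<le> bead \<nu> i}"
  have I: "bead \<nu> ` ?I = {s \<in> beads \<nu>. c \<le> s}"
    by (auto simp: beads_def)
  have "finite ?I"
    by (rule finite_imageD[of "bead \<nu>"])
      (simp_all add: I finite_beads_ge inj_on_subset[OF inj_bead])
  have cardI: "card {s \<in> beads \<nu>. c \<le> s} = card ?I"
    unfolding I[symmetric] by (intro card_image inj_on_subset[OF inj_bead]) auto
  have sub: "{..<nat (- c)} \<subseteq> ?I"
  proof
    fix i assume "i \<in> {..<nat (- c)}"
    then show "i \<in> ?I" using bead_ge[of i \<nu>] by auto
  qed
  have "bij_betw fst {b \<in> boxes \<nu>. box_content b = c} (?I - {..<nat (- c)})"
    by (rule bij_betw_byWitness[of _ "\<lambda>i. (i, nat (int i + c))"])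
      (auto simp: boxes_def box_content_def bead_def)
  then have "card {b \<in> boxes \<nu>. box_content b = c} = card (?I - {..<nat (- c)})"
    by (rule bij_betw_same_card)
  also have "\<dots> = card ?I - nat (- c)"
    using sub by (simp add: card_Diff_subset)
  finally have *: "card {b \<in> boxes \<nu>. box_content b = c} = card ?I - nat (- c)" .
  moreover have "nat (- c) \<le> card ?I"
    using card_mono[OF \<open>finite ?I\<close> sub] by simp
  ultimately show "int (card {b \<in> boxes \<nu>. box_content b = c}) =
      int (card {s \<in> beads \<nu>. c \<le> s}) - max 0 (- c)"
    unfolding cardI by (simp add: of_nat_diff)
qed

text \<open>Moving a bead from \<open>a\<close> to \<open>a + t\<close> raises the number of beads
  \<open>\<ge> c\<close> by one exactly for \<open>a < c \<le> a + t\<close>. So the added ribbon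
  has one box of each of these contents.\<close>

lemma hook_at_content_sum:
  fixes f :: "int \<Rightarrow> rat"
  assumes "hook_at t \<nu> a \<rho>"
  shows "(\<Sum>b\<in>boxes \<rho>. f (box_content b)) - (\<Sum>b\<in>boxes \<nu>. f (box_content b)) =
    (\<Sum>c\<in>{a + 1..a + int t}. f c)"
proof -
  \<comment> \<open>One finite set of contents that serves for both partitions and for the
    ribbon.\<close>
  define C where "C = box_content ` boxes \<nu> \<union> box_content ` boxes \<rho> \<union> {a + 1..a + int t}"
  have C: "finite C"
    by (simp add: C_def finite_boxes)
  have sum: "(\<Sum>b\<in>boxes \<sigma>. f (box_content b)) =
      (\<Sum>c\<in>C. f c * of_nat (card {b \<in> boxes \<sigma>. box_content b = c}))"
    if "box_content ` boxes \<sigma> \<subseteq> C" for \<sigma>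
  proof -
    have "(\<Sum>b\<in>boxes \<sigma>. f (box_content b)) =
        (\<Sum>c\<in>C. \<Sum>b | b \<in> boxes \<sigma> \<and> box_content b = c. f (box_content b))"
      using sum.group[OF finite_boxes C that, of "\<lambda>b. f (box_content b)"] by simp
    also have "\<dots> = (\<Sum>c\<in>C. f c * of_nat (card {b \<in> boxes \<sigma>. box_content b = c}))"
      by (intro sum.cong) auto
    finally show ?thesis .
  qed
  have card: "int (card {s \<in> beads \<rho>. c \<le> s}) =
      int (card {s \<in> beads \<nu>. c \<le> s}) + (if c \<in> {a + 1..a + int t} then 1 else 0)" for c
  proof -
    have h: "a \<in> beads \<nu>" "a + int t \<notin> beads \<nu>" "beads \<rho> = insert (a + int t) (beads \<nu> - {a})"
      using assms by (auto simp: hook_at_def)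
    consider "c \<le> a" | "a < c" "c \<le> a + int t" | "a + int t < c" by linarith
    then show ?thesis
    proof cases
      case 1
      have eq: "{s \<in> beads \<rho>. c \<le> s} = insert (a + int t) ({s \<in> beads \<nu>. c \<le> s} - {a})"
        unfolding h(3) using 1 by auto
      have "Suc (card ({s \<in> beads \<nu>. c \<le> s} - {a})) = card {s \<in> beads \<nu>. c \<le> s}"
        using h 1 finite_beads_ge[of \<nu> c] by (intro card_Suc_Diff1) auto
      moreover have "card {s \<in> beads \<rho>. c \<le> s} = Suc (card ({s \<in> beads \<nu>. c \<le> s} - {a}))"
        unfolding eq using h finite_beads_ge[of \<nu> c] by (intro card_insert_disjoint) auto
      ultimately show ?thesis
        using 1 by simp
    next
      case 2
      have "{s \<in> beads \<rho>. c \<le> s} = insert (a + int t) {s \<in> beads \<nu>. c \<le> s}"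
        unfolding h(3) using 2 by auto
      moreover have "a + int t \<notin> {s \<in> beads \<nu>. c \<le> s}"
        using h by blast
      ultimately show ?thesis
        using 2 by (simp add: finite_beads_ge)
    next
      case 3
      have "{s \<in> beads \<rho>. c \<le> s} = {s \<in> beads \<nu>. c \<le> s}"
        unfolding h(3) using 3 by auto
      then show ?thesis
        using 3 by simp
    qed
  qed
  have "of_nat (card {b \<in> boxes \<rho>. box_content b = c}) =
      (of_nat (card {b \<in> boxes \<nu>. box_content b = c}) +
        (if c \<in> {a + 1..a + int t} then 1 else 0) :: rat)" for c
  proof -
    have "int (card {b \<in> boxes \<rho>. box_content b = c}) =
        int (card {b \<in> boxes \<nu>. box_content b = c}) + (if c \<in> {a + 1..a + int t} then 1 else 0)"
      unfolding card_boxes_content card by simp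
    then have "rat_of_int (int (card {b \<in> boxes \<rho>. box_content b = c})) =
        rat_of_int (int (card {b \<in> boxes \<nu>. box_content b = c}) + (if c \<in> {a + 1..a + int t} then 1 else 0))"
      by simp
    then show ?thesis by simp
  qed
  then have "(\<Sum>b\<in>boxes \<rho>. f (box_content b)) =
      (\<Sum>c\<in>C. f c * (of_nat (card {b \<in> boxes \<nu>. box_content b = c}) +
        (if c \<in> {a + 1..a + int t} then 1 else 0)))"
    by (subst sum) (auto simp: C_def)
  also have "\<dots> = (\<Sum>c\<in>C. f c * of_nat (card {b \<in> boxes \<nu>. box_content b = c})) +
      (\<Sum>c\<in>C. if c \<in> {a + 1..a + int t} then f c else 0)"
    unfolding distrib_left sum.distrib by (intro arg_cong2[of _ _ _ _ "(+)"] sum.cong) auto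
  also have "(\<Sum>c\<in>C. f c * of_nat (card {b \<in> boxes \<nu>. box_content b = c})) =
      (\<Sum>b\<in>boxes \<nu>. f (box_content b))"
    by (subst sum) (auto simp: C_def)
  finally have "(\<Sum>b\<in>boxes \<rho>. f (box_content b)) - (\<Sum>b\<in>boxes \<nu>. f (box_content b)) =
      (\<Sum>c\<in>C. if c \<in> {a + 1..a + int t} then f c else 0)"
    by simp
  also have "\<dots> = (\<Sum>c\<in>C \<inter> {a + 1..a + int t}. f c)"
    using C by (simp add: sum.inter_restrict)
  also have "C \<inter> {a + 1..a + int t} = {a + 1..a + int t}"
    by (auto simp: C_def)
  finally show ?thesis .
qed

lemma psize_hook_at:
  assumes "hook_at t \<nu> a \<rho>"
  shows "psize \<rho> = psize \<nu> + t"
proof -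
  have "rat_of_nat (psize \<rho>) - of_nat (psize \<nu>) = of_nat t"
    using hook_at_content_sum[OF assms, of "\<lambda>_. 1"] by (simp add: psize_def)
  then have "rat_of_nat (psize \<rho>) = rat_of_nat (psize \<nu> + t)"
    by simp
  then show ?thesis
    using of_nat_eq_iff by blast
qed

lemma psize_add_hook: "add_hook t \<nu> \<rho> \<Longrightarrow> psize \<rho> = psize \<nu> + t"
  using psize_hook_at by (auto simp: add_hook_iff)

text \<open>Singles out the moving bead \<open>a\<close>. The remaining beads \<open>B\<close> are
  the same before and after the move, so whatever involves only \<open>B\<close> cancels when the
  two instances are compared.\<close>

lemma (in comm_monoid_set) bead_pairs_insert_window:
  assumes low: "\<And>k. k < b \<Longrightarrow> k \<in> S" and B: "{s \<in> S. b \<le> s} = insert a B" "finite B" "a \<notin> B"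
    and even: "\<And>x. \<phi> (- x) = \<phi> x"
  shows "F (\<lambda>(g, s). \<phi> (s - g)) (bead_pairs S) \<^bold>*
           (F (\<lambda>(g, s). \<phi> (s - g)) {(g, s). g \<in> B \<and> s \<in> B \<and> g < s} \<^bold>* F (\<lambda>l. \<phi> (a - l)) B) =
         F \<phi> {1..a - b} \<^bold>* F (\<lambda>s. F \<phi> {1..s - b}) B"
proof -
  have "finite {s \<in> S. b \<le> s}"
    using B by simp
  from bead_pairs_window[OF low this, of \<phi>] show ?thesis
    unfolding B(1) pairs_insert[where \<phi> = \<phi>, OF B(2,3) even] using B(2,3) by simp
qed

lemma hook_at_window:
  assumes "hook_at t \<nu> a \<rho>" "b \<le> a"
  shows "{s \<in> beads \<nu>. b \<le> s} = insert a ({s \<in> beads \<nu>. b \<le> s} - {a})"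
    and "{s \<in> beads \<rho>. b \<le> s} = insert (a + int t) ({s \<in> beads \<nu>. b \<le> s} - {a})"
    and "a + int t \<notin> {s \<in> beads \<nu>. b \<le> s} - {a}"
  using assms by (auto simp: hook_at_def)

lemma hook_at_low:
  assumes "hook_at t \<nu> a \<rho>" "b \<le> a" "\<And>k. k < b \<Longrightarrow> k \<in> beads \<nu>" "k < b"
  shows "k \<in> beads \<rho>"
  using assms by (auto simp: hook_at_def)

section \<open>Bead sums and hook sums\<close>

text \<open>
  The infinite sum of \<open>f\<close> over all beads, regularized so that the empty partition, whose beads are the
  negative positions, has sum 0.
\<close>

definition bead_sum :: "int_partition \<Rightarrow> (int \<Rightarrow> rat) \<Rightarrow> rat" where
  "bead_sum \<nu> f = (\<Sum>s | s \<in> beads \<nu> \<and> 0 \<le> s. f s) - (\<Sum>s | s \<notin> beads \<nu> \<and> s < 0. f s)"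

text \<open>The beads in \<open>{b..-1}\<close> contribute to both terms and cancel, so any
  sufficiently low \<open>b\<close> can serve as the end of the window.\<close>

lemma bead_sum_window:
  assumes "\<And>k. k < b \<Longrightarrow> k \<in> beads \<nu>" "b \<le> 0"
  shows "bead_sum \<nu> f = (\<Sum>s | s \<in> beads \<nu> \<and> b \<le> s. f s) - (\<Sum>s\<in>{b..-1}. f s)"
proof -
  have 1: "{s \<in> beads \<nu>. b \<le> s} = {s \<in> beads \<nu>. 0 \<le> s} \<union> {s \<in> beads \<nu>. b \<le> s \<and> s < 0}"
    using assms(2) by auto
  have fin: "finite {s \<in> beads \<nu>. b \<le> s \<and> s < 0}"
    by (rule finite_subset[of _ "{b..-1}"]) auto
  have 2: "{b..-1} = {s. s \<notin> beads \<nu> \<and> s < 0} \<union> {s \<in> beads \<nu>. b \<le> s \<and> s < 0}"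
  proof (intro set_eqI iffI)
    fix s assume "s \<in> {b..-1}"
    then show "s \<in> {s. s \<notin> beads \<nu> \<and> s < 0} \<union> {s \<in> beads \<nu>. b \<le> s \<and> s < 0}"
      by auto
  next
    fix s assume "s \<in> {s. s \<notin> beads \<nu> \<and> s < 0} \<union> {s \<in> beads \<nu>. b \<le> s \<and> s < 0}"
    then show "s \<in> {b..-1}"
      using assms(1)[of s] by (cases "s < b") auto
  qed
  have "finite {s. s \<notin> beads \<nu> \<and> s < 0}"
    by (rule finite_subset[OF _ finite_atLeastAtMost_int[of b "-1"]]) (unfold 2, blast)
  then have "(\<Sum>s\<in>{b..-1}. f s) =
      (\<Sum>s | s \<notin> beads \<nu> \<and> s < 0. f s) + (\<Sum>s | s \<in> beads \<nu> \<and> b \<le> s \<and> s < 0. f s)"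
    unfolding 2 using fin by (intro sum.union_disjoint) auto
  moreover have "(\<Sum>s | s \<in> beads \<nu> \<and> b \<le> s. f s) =
      (\<Sum>s | s \<in> beads \<nu> \<and> 0 \<le> s. f s) + (\<Sum>s | s \<in> beads \<nu> \<and> b \<le> s \<and> s < 0. f s)"
    unfolding 1 using fin finite_beads_ge by (intro sum.union_disjoint) auto
  ultimately show ?thesis
    by (simp add: bead_sum_def)
qed

lemma beads_low_le:
  fixes c :: int
  obtains b where "b \<le> c" "\<And>k. k \<le> b \<Longrightarrow> k \<in> beads \<nu>"
proof -
  obtain N where "\<And>k. k \<le> N \<Longrightarrow> k \<in> beads \<nu>"
    using beads_low by blast
  then show ?thesis
    by (intro that[of "min N c"]) auto
qed

lemma bead_sum_hook_at:
  assumes "hook_at t \<nu> a \<rho>"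
  shows "bead_sum \<rho> f - bead_sum \<nu> f = f (a + int t) - f a"
proof -
  obtain b where b: "b \<le> min a 0" "\<And>k. k \<le> b \<Longrightarrow> k \<in> beads \<nu>"
    using beads_low_le by blast
  define B where "B = {s \<in> beads \<nu>. b \<le> s} - {a}"
  have ba: "b \<le> a"
    using b by simp
  note w = hook_at_window[OF assms ba, folded B_def]
  have B: "finite B" "a \<notin> B"
    by (simp_all add: B_def finite_beads_ge)
  have "bead_sum \<nu> f = (\<Sum>s\<in>insert a B. f s) - (\<Sum>s\<in>{b..-1}. f s)"
    using b w(1) by (subst bead_sum_window[of b]) auto
  moreover have "bead_sum \<rho> f = (\<Sum>s\<in>insert (a + int t) B. f s) - (\<Sum>s\<in>{b..-1}. f s)"
    using b w(2) hook_at_low[OF assms, of b] by (subst bead_sum_window[of b]) auto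
  ultimately show ?thesis
    using B w(3) by simp
qed

text \<open>Comparing the window formulas of both partitions leaves two interval sums and a sum over
  the fixed beads. Completing the latter to \<open>bead_sum\<close> makes the auxiliary bound
  \<open>b\<close> disappear, so that the change depends only on \<open>a\<close> and on a
  regularized sum over the beads of \<open>\<nu>\<close>.\<close>

lemma hook_at_hook_sum:
  fixes f :: "int \<Rightarrow> rat"
  assumes h: "hook_at t \<nu> a \<rho>" and even: "\<And>x. f (- x) = f x"
  shows "(\<Sum>b\<in>boxes \<rho>. f (int (hook_length \<rho> b))) - (\<Sum>b\<in>boxes \<nu>. f (int (hook_length \<nu> b))) =
    f (int t) - f 0 + (\<Sum>d\<in>{1..int t}. f (a + d)) -
    bead_sum \<nu> (\<lambda>i. f (a - i + int t) - f (a - i))"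
proof -
  obtain b where b: "b \<le> min a 0" "\<And>k. k \<le> b \<Longrightarrow> k \<in> beads \<nu>"
    using beads_low_le by blast
  define B where "B = {s \<in> beads \<nu>. b \<le> s} - {a}"
  define \<alpha> where "\<alpha> i = f (a - i + int t) - f (a - i)" for i
  have ba: "b \<le> a"
    using b by simp
  note w = hook_at_window[OF h ba, folded B_def]
  have fin: "finite B"
    by (simp add: B_def finite_beads_ge)
  have aB: "a \<notin> B"
    by (simp add: B_def)
  have low: "k < b \<Longrightarrow> k \<in> beads \<nu>" for k
    using b by simp
  have low': "k < b \<Longrightarrow> k \<in> beads \<rho>" for k
    using hook_at_low[OF h ba low] by simp
  note e1 = sum.bead_pairs_insert_window[where \<phi> = f, OF low w(1) fin aB even]
  note e2 = sum.bead_pairs_insert_window[where \<phi> = f, OF low' w(2) fin w(3) even]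
  have "(\<Sum>b\<in>boxes \<rho>. f (int (hook_length \<rho> b))) - (\<Sum>b\<in>boxes \<nu>. f (int (hook_length \<nu> b))) =
      sum f {1..a + int t - b} - sum f {1..a - b} - (\<Sum>l\<in>B. \<alpha> l)"
    using e1 e2 by (simp add: sum.hooks_eq_bead_pairs \<alpha>_def sum_subtractf algebra_simps)
  \<comment> \<open>The moving bead is put back to obtain all beads of the window; its term
    \<open>\<alpha> a\<close> is \<open>f (int t) - f 0\<close>.\<close>
  also have "(\<Sum>l\<in>B. \<alpha> l) = (\<Sum>l\<in>insert a B. \<alpha> l) - (f (int t) - f 0)"
    using fin aB by (simp add: \<alpha>_def)
  also have "(\<Sum>l\<in>insert a B. \<alpha> l) = bead_sum \<nu> \<alpha> + (\<Sum>i\<in>{b..-1}. \<alpha> i)"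
    using bead_sum_window[OF low, of b \<alpha>] b w(1) by simp
  also have "(\<Sum>i\<in>{b..-1}. \<alpha> i) = sum f {a + int t + 1..a + int t - b} - sum f {a + 1..a - b}"
    unfolding \<alpha>_def sum_subtractf
    by (intro arg_cong2[of _ _ _ _ "(-)"]
        sum.reindex_bij_witness[of _ "\<lambda>x. a + int t - x" "\<lambda>i. a - i + int t"]
        sum.reindex_bij_witness[of _ "\<lambda>x. a - x" "\<lambda>i. a - i"]) auto
  also have "sum f {1..a + int t - b} = sum f {1..a - b} + sum f {a - b + 1..a + int t - b}"
  proof -
    have "{1..a + int t - b} = {1..a - b} \<union> {a - b + 1..a + int t - b}"
      using ba by auto
    then show ?thesis
      by (simp add: sum.union_disjoint)
  qed
  \<comment> \<open>The interval from \<open>a + 1\<close> to \<open>a + int t - b\<close> is split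
    once after \<open>a + int t\<close> and once after \<open>a - b\<close>.\<close>
  also have "sum f {a - b + 1..a + int t - b} =
      sum f {a + 1..a + int t} + sum f {a + int t + 1..a + int t - b} - sum f {a + 1..a - b}"
  proof -
    have "{a + 1..a + int t} \<union> {a + int t + 1..a + int t - b} =
        {a + 1..a - b} \<union> {a - b + 1..a + int t - b}"
      using b by auto
    then have "sum f ({a + 1..a + int t} \<union> {a + int t + 1..a + int t - b}) =
        sum f ({a + 1..a - b} \<union> {a - b + 1..a + int t - b})"
      by simp
    then show ?thesis
      by (simp add: sum.union_disjoint)
  qed
  also have "sum f {a + 1..a + int t} = (\<Sum>d\<in>{1..int t}. f (a + d))"
    by (rule sum.reindex_bij_witness[of _ "\<lambda>d. a + d" "\<lambda>x. x - a"]) auto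
  finally show ?thesis
    by (simp add: \<alpha>_def[abs_def])
qed

section \<open>Weights of addable hooks\<close>

lemma prod_linear_factors:
  fixes c :: "'b \<Rightarrow> 'a::idom"
  assumes "finite B"
  shows "degree (\<Prod>j\<in>B. [:c j, 1:]) = card B"
    and "coeff (\<Prod>j\<in>B. [:c j, 1:]) (card B) = 1"
    and "B \<noteq> {} \<Longrightarrow> coeff (\<Prod>j\<in>B. [:c j, 1:]) (card B - 1) = sum c B"
proof -
  have deg: "degree (\<Prod>j\<in>B. [:c j, 1:]) = card B" if "finite B" for B
    using that by (subst degree_prod_eq_sum_degree) auto
  have lead: "coeff (\<Prod>j\<in>B. [:c j, 1:]) (card B) = 1" if "finite B" for B
    using lead_coeff_prod[of "\<lambda>j. [:c j, 1:]" B] deg[OF that] by simp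
  show "degree (\<Prod>j\<in>B. [:c j, 1:]) = card B" "coeff (\<Prod>j\<in>B. [:c j, 1:]) (card B) = 1"
    using deg lead assms by blast+
  assume "B \<noteq> {}"
  with assms show "coeff (\<Prod>j\<in>B. [:c j, 1:]) (card B - 1) = sum c B"
  proof (induction rule: finite_ne_induct)
    case (insert x B)
    obtain m where m: "card B = Suc m"
      using insert by (metis card_gt_0_iff gr0_implies_Suc)
    have "coeff (\<Prod>j\<in>insert x B. [:c j, 1:]) (card (insert x B) - 1) =
        c x * coeff (\<Prod>j\<in>B. [:c j, 1:]) (card B) + coeff (\<Prod>j\<in>B. [:c j, 1:]) (card B - 1)"
      using insert by (simp add: m)
    then show ?case
      using insert lead by simp
  qed simp
qed

text \<open>A polynomial of degree below \<open>card B\<close> equals its interpolation polynomial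
  at \<open>B\<close>, and each monic basis polynomial \<open>L s\<close> contributes its weight to
  the coefficient of degree \<open>card B - 1\<close>.\<close>

lemma lagrange_lead_coeff:
  fixes B :: "'a::field set"
  assumes "finite B" "degree p < card B"
  shows "(\<Sum>s\<in>B. poly p s / (\<Prod>j\<in>B - {s}. s - j)) = coeff p (card B - 1)"
proof -
  define L where "L s = (\<Prod>j\<in>B - {s}. [:- j, 1:])" for s
  define q where "q = (\<Sum>s\<in>B. smult (poly p s / (\<Prod>j\<in>B - {s}. s - j)) (L s))"
  have L: "degree (L s) = card B - 1" "coeff (L s) (card B - 1) = 1" if "s \<in> B" for s
    using prod_linear_factors(1,2)[of "B - {s}" uminus] assms(1) that by (simp_all add: L_def)
  have pL: "poly (L s) x = (\<Prod>j\<in>B - {s}. x - j)" for s x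
    by (simp add: L_def poly_prod)
  have "poly q x = poly p x" if "x \<in> B" for x
  proof -
    have "poly q x = (\<Sum>s\<in>B. poly p s / (\<Prod>j\<in>B - {s}. s - j) * (\<Prod>j\<in>B - {s}. x - j))"
      by (simp add: q_def poly_sum pL)
    also have "\<dots> = (\<Sum>s\<in>B. if s = x then poly p x else 0)"
    proof (rule sum.cong)
      fix s assume "s \<in> B"
      have "(\<Prod>j\<in>B - {x}. x - j) \<noteq> 0"
        using assms(1) by auto
      moreover have "(\<Prod>j\<in>B - {s}. x - j) = 0" if "s \<noteq> x"
        using that \<open>x \<in> B\<close> assms(1) by (intro prod_zero) auto
      ultimately show "poly p s / (\<Prod>j\<in>B - {s}. s - j) * (\<Prod>j\<in>B - {s}. x - j) =
          (if s = x then poly p x else 0)"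
        by simp
    qed simp
    also have "\<dots> = poly p x"
      using assms(1) that by simp
    finally show ?thesis .
  qed
  moreover have "degree q < card B"
  proof -
    have "degree q \<le> card B - 1"
      unfolding q_def using L by (intro degree_sum_le assms(1)) (metis degree_smult_le)
    then show ?thesis
      using assms(2) by linarith
  qed
  ultimately have "q = p"
    using assms(2) by (intro poly_eqI_degree[of B]) auto
  then have "coeff p (card B - 1) = coeff q (card B - 1)"
    by simp
  also have "\<dots> = (\<Sum>s\<in>B. poly p s / (\<Prod>j\<in>B - {s}. s - j))"
    by (simp add: q_def coeff_sum L(2)[unfolded One_nat_def])
  finally show ?thesis ..
qed

lemma lagrange_lead_coeff_of_int:
  fixes p :: "rat poly" and B :: "int set"
  assumes "finite B" "degree p < card B"
  shows "(\<Sum>s\<in>B. poly p (of_int s) / (\<Prod>j\<in>B - {s}. of_int (s - j))) = coeff p (card B - 1)"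
proof -
  have inj: "inj_on rat_of_int A" for A
    by (simp add: inj_on_def)
  have "(\<Prod>j\<in>of_int ` B - {rat_of_int s}. of_int s - j) = (\<Prod>j\<in>B - {s}. of_int (s - j))" for s
  proof -
    have "of_int ` B - {rat_of_int s} = of_int ` (B - {s})"
      by auto
    then show ?thesis
      by (simp add: prod.reindex[OF inj] o_def)
  qed
  note eq = this
  have "(\<Sum>s\<in>of_int ` B. poly p s / (\<Prod>j\<in>of_int ` B - {s}. s - j)) =
      (\<Sum>s\<in>B. poly p (of_int s) / (\<Prod>j\<in>B - {s}. of_int (s - j)))"
    by (subst sum.reindex[OF inj]) (simp only: o_def eq)
  then show ?thesis
    using lagrange_lead_coeff[of "rat_of_int ` B" p] assms by (simp only: card_image[OF inj] finite_imageI)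
qed

section \<open>Weights on one runner and their power sums\<close>

text \<open>
  For the set \<open>B\<close> of the beads \<open>\<ge> b\<close> on one runner, this is \<open>t G \<rho> / G \<nu>\<close> for the hook added at
  \<open>s \<in> B\<close>; it vanishes at the beads \<open>s\<close> where no hook can be added.
\<close>

definition bead_weight :: "nat \<Rightarrow> int \<Rightarrow> int set \<Rightarrow> int \<Rightarrow> rat" where
  "bead_weight t b B s =
     (\<Prod>j\<in>B - {b}. of_int (s + int t - j)) / (\<Prod>j\<in>B - {s}. of_int (s - j))"

lemma bead_weight_poly:
  "bead_weight t b B s =
     poly (\<Prod>j\<in>B - {b}. [:of_int (int t - j), 1:]) (of_int s) / (\<Prod>j\<in>B - {s}. of_int (s - j))"
proof -
  have "poly (\<Prod>j\<in>B - {b}. [:of_int (int t - j), 1:]) (rat_of_int s) =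
      (\<Prod>j\<in>B - {b}. of_int (s + int t - j))"
    unfolding poly_prod by (rule prod.cong) simp_all
  then show ?thesis
    by (simp only: bead_weight_def)
qed

text \<open>The numerators are the values of a monic polynomial of degree \<open>card B - 1\<close>,
  so interpolation returns its leading coefficient.\<close>

lemma sum_bead_weight:
  assumes "finite B" "b \<in> B"
  shows "(\<Sum>s\<in>B. bead_weight t b B s) = 1"
proof -
  let ?p = "\<Prod>j\<in>B - {b}. [:rat_of_int (int t - j), 1:]"
  have c: "card B = Suc (card (B - {b}))"
    using assms by (rule card.remove)
  have "degree ?p = card (B - {b})" "coeff ?p (card (B - {b})) = 1"
    using assms prod_linear_factors(1,2)[of "B - {b}" "\<lambda>j. rat_of_int (int t - j)"] by auto
  then show ?thesis
    unfolding bead_weight_poly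
    using lagrange_lead_coeff_of_int[OF assms(1), of ?p] c by simp
qed

text \<open>The result depends only on \<open>b\<close> and the number of beads, neither of which
  changes when a bead moves. This is the source of the invariance of the first moment.\<close>

lemma sum_bead_weight_mult:
  assumes "finite B" "b \<in> B"
  shows "(\<Sum>s\<in>B. bead_weight t b B s * of_int s) = of_nat t * of_nat (card B - 1) + of_int b"
proof -
  let ?p = "\<Prod>j\<in>B - {b}. [:rat_of_int (int t - j), 1:]"
  let ?m = "\<Prod>j\<in>B. [:- rat_of_int j, 1:]"
  \<comment> \<open>Multiplying by the variable raises the degree to \<open>card B\<close>, one too
    many. Subtracting the monic polynomial with root set \<open>B\<close> restores the bound and
    keeps the values on \<open>B\<close>.\<close>
  define q where "q = [:0, 1:] * ?p - ?m"
  have c: "card B = Suc (card (B - {b}))"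
    using assms by (rule card.remove)
  have B: "B \<noteq> {}"
    using assms by auto
  have p: "degree ?p = card (B - {b})" "coeff ?p (card (B - {b})) = 1"
    using assms prod_linear_factors(1,2)[of "B - {b}" "\<lambda>j. rat_of_int (int t - j)"] by auto
  have m: "degree ?m = card B" "coeff ?m (card B) = 1"
    "coeff ?m (card B - 1) = (\<Sum>j\<in>B. - rat_of_int j)"
    using prod_linear_factors[OF assms(1), of "\<lambda>j. - rat_of_int j"] B by auto
  have "degree q \<le> card B"
    unfolding q_def using p m c by (intro degree_diff_le) (auto intro: degree_pCons_le order_trans)
  moreover have "coeff q (card B) = 0"
    using p m c by (simp add: q_def)
  ultimately have "degree q < card B"
    using c by (metis Suc_leI coeff_0_degree_minus_1 diff_Suc_1 lessI less_Suc_eq_le linorder_not_le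
        le_neq_implies_less leading_coeff_0_iff degree_0 zero_less_Suc)
  from lagrange_lead_coeff_of_int[OF assms(1) this]
  have "coeff q (card B - 1) =
      (\<Sum>s\<in>B. poly q (of_int s) / (\<Prod>j\<in>B - {s}. of_int (s - j)))" ..
  also have "\<dots> = (\<Sum>s\<in>B. bead_weight t b B s * of_int s)"
  proof (rule sum.cong)
    fix s assume "s \<in> B"
    then have "poly ?m (of_int s) = 0"
      using assms(1) by (auto simp: poly_prod intro!: prod_zero)
    then show "poly q (of_int s) / (\<Prod>j\<in>B - {s}. of_int (s - j)) = bead_weight t b B s * of_int s"
      by (simp add: q_def bead_weight_poly)
  qed simp
  also have "coeff q (card B - 1) = (\<Sum>j\<in>B - {b}. rat_of_int (int t - j)) + (\<Sum>j\<in>B. rat_of_int j)"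
  proof (cases "B - {b} = {}")
    case True
    then have "B = {b}"
      using assms by blast
    then show ?thesis
      by (simp add: q_def)
  next
    case False
    then have "card (B - {b}) = Suc (card (B - {b}) - 1)"
      using assms(1) by (simp add: card_gt_0_iff)
    then have "coeff ([:0, 1:] * ?p) (card B - 1) = coeff ?p (card (B - {b}) - 1)"
      using c by (simp add: coeff_pCons split: nat.split)
    then show ?thesis
      using c m(3) assms(1) False prod_linear_factors(3)[of "B - {b}" "\<lambda>j. rat_of_int (int t - j)"]
      by (simp add: q_def sum_negf)
  qed
  also have "\<dots> = of_nat t * of_nat (card B - 1) + of_int b"
    using c sum.remove[OF assms, of rat_of_int] by (simp add: sum_subtractf)
  finally show ?thesis by simp
qed

text \<open>Replacing \<open>a\<close> by \<open>a + t\<close> turns the numerator factor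
  \<open>s - a + t\<close> into \<open>s - a\<close> and the denominator factor \<open>s - a\<close>
  into \<open>s - a - t\<close>. The weight is thus multiplied by
  \<open>(s - a)^2 / ((s - a)^2 - t^2)\<close>, stated here without division.\<close>

lemma bead_weight_move:
  assumes "finite B" "a \<in> B" "a \<noteq> b" "a + int t \<notin> B" "s \<in> B" "s \<noteq> a" "b \<noteq> a + int t"
  shows "bead_weight t b (insert (a + int t) (B - {a})) s * (of_int (s - a)^2 - of_int (int t)^2) =
    bead_weight t b B s * of_int (s - a)^2"
proof -
  let ?B' = "insert (a + int t) (B - {a})"
  have st: "s \<noteq> a + int t"
    using assms by auto
  define n where "n = (\<Prod>j\<in>B - {a, b}. rat_of_int (s + int t - j))"
  define d where "d = (\<Prod>j\<in>B - {a, s}. rat_of_int (s - j))"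
  have ins: "prod f X = f x * prod f A" if "X = insert x A" "x \<notin> A" "A \<subseteq> B"
    for f :: "int \<Rightarrow> rat" and X A x
    using that assms(1) finite_subset[of A B] by simp
  have 1: "(\<Prod>j\<in>?B' - {b}. rat_of_int (s + int t - j)) = of_int (s - a) * n"
    unfolding n_def by (subst ins[of _ "a + int t" "B - {a, b}"]) (use assms in auto)
  have 2: "(\<Prod>j\<in>?B' - {s}. rat_of_int (s - j)) = of_int (s - (a + int t)) * d"
    unfolding d_def by (subst ins[of _ "a + int t" "B - {a, s}"]) (use assms in auto)
  have 3: "(\<Prod>j\<in>B - {b}. rat_of_int (s + int t - j)) = of_int (s + int t - a) * n"
    unfolding n_def by (subst ins[of _ a "B - {a, b}"]) (use assms in auto)
  have 4: "(\<Prod>j\<in>B - {s}. rat_of_int (s - j)) = of_int (s - a) * d"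
    unfolding d_def by (subst ins[of _ a "B - {a, s}"]) (use assms in auto)
  have d: "d \<noteq> 0"
    using assms(1) by (auto simp: d_def)
  have ne: "rat_of_int (s - (a + int t)) \<noteq> 0" "rat_of_int (s - a) \<noteq> 0"
    unfolding of_int_eq_0_iff using st assms by auto
  have sq: "rat_of_int (s - a)^2 - of_int (int t)^2 = of_int (s - (a + int t)) * of_int (s + int t - a)"
    by (simp add: power2_eq_square algebra_simps)
  show ?thesis
    unfolding bead_weight_def 1 2 3 4 sq using d ne by (simp add: divide_simps power2_eq_square)
qed

lemma bead_weight_0:
  assumes "finite B" "s + int t \<in> B" "s + int t \<noteq> b"
  shows "bead_weight t b B s = 0"
  using assms by (auto simp: bead_weight_def intro!: prod_zero bexI[of _ "s + int t"])

text \<open>The moving bead escapes \<open>bead_weight_move\<close>, but does no harm: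
  \<open>(s - a)^2\<close> vanishes at its old position \<open>a\<close>, and
  \<open>(s - a)^2 - t^2\<close> at the new one.\<close>

lemma sum_bead_weight_move:
  assumes "finite B" "a \<in> B" "a \<noteq> b" "b \<noteq> a + int t" "a + int t \<notin> B"
  shows "(\<Sum>s\<in>insert (a + int t) (B - {a}).
      bead_weight t b (insert (a + int t) (B - {a})) s * (of_int (s - a)^2 - of_int (int t)^2) * of_int s ^ k) =
    (\<Sum>s\<in>B. bead_weight t b B s * of_int (s - a)^2 * of_int s ^ k)"
proof -
  let ?f = "\<lambda>s. bead_weight t b (insert (a + int t) (B - {a})) s *
      (of_int (s - a)^2 - of_int (int t)^2) * rat_of_int s ^ k"
  have "sum ?f (insert (a + int t) (B - {a})) = sum ?f (B - {a})"
    using assms by (subst sum.insert) auto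
  also have "\<dots> = (\<Sum>s\<in>B - {a}. bead_weight t b B s * of_int (s - a)^2 * of_int s ^ k)"
  proof (rule sum.cong)
    fix s assume "s \<in> B - {a}"
    then show "?f s = bead_weight t b B s * of_int (s - a)^2 * of_int s ^ k"
      using assms by (subst bead_weight_move) auto
  qed simp
  also have "\<dots> = (\<Sum>s\<in>B. bead_weight t b B s * of_int (s - a)^2 * of_int s ^ k)"
    using sum.remove[OF assms(1,2), of "\<lambda>s. bead_weight t b B s * of_int (s - a)^2 * of_int s ^ k"]
    by simp
  finally show ?thesis .
qed

text \<open>The contribution of a hook length to \<open>1 / G\<close>, with value 1 off the
  multiples of \<open>t\<close> so that the product runs over all boxes, and extended evenly to the
  integers as \<open>pairs_insert\<close> demands.\<close>

definition hook_factor :: "nat \<Rightarrow> int \<Rightarrow> rat" where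
  "hook_factor t x = (if int t dvd x then of_int \<bar>x\<bar> else 1)"

lemma hook_factor_minus [simp]: "hook_factor t (- x) = hook_factor t x"
  by (simp add: hook_factor_def)

lemma hook_factor_eq_0_iff [simp]: "hook_factor t x = 0 \<longleftrightarrow> x = 0"
  by (auto simp: hook_factor_def)

lemma G_hook_factor: "G t \<nu> = 1 / (\<Prod>b\<in>boxes \<nu>. hook_factor t (int (hook_length \<nu> b)))"
proof -
  have "(\<Prod>h \<in># filter_mset (\<lambda>h. t dvd h) (hook_lengths \<nu>). rat_of_nat h) =
      (\<Prod>b | b \<in> boxes \<nu> \<and> t dvd hook_length \<nu> b. rat_of_nat (hook_length \<nu> b))"
    by (simp add: hook_lengths_def filter_mset_image_mset image_mset.compositionality o_def
        finite_boxes prod_unfold_prod_mset)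
  also have "\<dots> = (\<Prod>b\<in>boxes \<nu>. hook_factor t (int (hook_length \<nu> b)))"
    by (subst prod.inter_filter) (auto simp: finite_boxes hook_factor_def intro!: prod.cong)
  finally show ?thesis
    by (simp add: G_def)
qed

lemma G_nonzero: "G t \<nu> \<noteq> 0"
  by (simp add: G_hook_factor finite_boxes) (simp add: hook_length_def)

text \<open>On the same runner, \<open>a - l\<close> and \<open>a + t - l\<close> are consecutive
  multiples of \<open>t\<close>. Since neither is zero they have the same sign, and the absolute
  values cancel in the quotient.\<close>

lemma hook_factor_ratio:
  assumes "0 < t" "l mod int t = a mod int t" "l \<noteq> a" "l \<noteq> a + int t"
  shows "hook_factor t (a + int t - l) / hook_factor t (a - l) = of_int (a + int t - l) / of_int (a - l)"
proof -
  have dvd: "int t dvd a - l"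
    using assms(2) by (metis mod_eq_dvd_iff)
  then have "int t dvd a + int t - l"
    by (metis add_diff_eq add.commute dvd_add_times_triv_left_iff mult_1 diff_add_eq)
  obtain q where q: "a - l = int t * q"
    using dvd by blast
  have "q \<noteq> 0" "q \<noteq> - 1"
    using assms q by auto
  then have "q * (q + 1) > 0"
    by (cases "q > 0") (auto intro: mult_neg_neg mult_pos_pos)
  have "int t * int t * (q * (q + 1)) > 0"
    by (rule mult_pos_pos) (use assms(1) \<open>q * (q + 1) > 0\<close> in simp_all)
  moreover have "(a + int t - l) * (a - l) = int t * int t * (q * (q + 1))"
  proof -
    have "a + int t - l = int t * (q + 1)"
      using q by (simp add: algebra_simps)
    then show ?thesis
      using q by (simp add: algebra_simps)
  qed
  ultimately have "(a + int t - l) * (a - l) > 0"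
    by simp
  then have "\<bar>a + int t - l\<bar> = a + int t - l \<and> \<bar>a - l\<bar> = a - l \<or>
      \<bar>a + int t - l\<bar> = - (a + int t - l) \<and> \<bar>a - l\<bar> = - (a - l)"
    by (auto simp: zero_less_mult_iff)
  then show ?thesis
    using dvd \<open>int t dvd a + int t - l\<close> unfolding hook_factor_def
    by (elim disjE conjE) (simp_all only: if_True of_int_minus minus_divide_divide)
qed

text \<open>Among the \<open>t\<close> new factors only the last argument is a multiple of
  \<open>t\<close>.\<close>

lemma prod_hook_factor_extend:
  assumes "0 < t" "int t dvd c" "0 \<le> c"
  shows "(\<Prod>x\<in>{1..c + int t}. hook_factor t x) = (\<Prod>x\<in>{1..c}. hook_factor t x) * of_int (c + int t)"
proof -
  have "{1..c + int t} = insert (c + int t) ({1..c} \<union> {c + 1..<c + int t})"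
    using assms by auto
  then have "(\<Prod>x\<in>{1..c + int t}. hook_factor t x) =
      hook_factor t (c + int t) * ((\<Prod>x\<in>{1..c}. hook_factor t x) * (\<Prod>x\<in>{c + 1..<c + int t}. hook_factor t x))"
    using assms by (subst prod.union_disjoint[symmetric]) auto
  moreover have "(\<Prod>x\<in>{c + 1..<c + int t}. hook_factor t x) = 1"
  proof (rule prod.neutral, rule ballI)
    fix x assume x: "x \<in> {c + 1..<c + int t}"
    have "\<not> int t dvd x - c"
      using x by (intro zdvd_not_zless) auto
    then have "\<not> int t dvd x"
      using assms(2) dvd_diff by blast
    then show "hook_factor t x = 1"
      by (simp add: hook_factor_def)
  qed
  moreover have "hook_factor t (c + int t) = of_int (c + int t)"
    using assms by (simp add: hook_factor_def)
  ultimately show ?thesis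
    by simp
qed

text \<open>In the quotient of the two window products everything that avoids the moving bead
  cancels. What remains is a product over the other beads, in which only those on the runner of
  \<open>a\<close> contribute.\<close>

lemma G_hook_at_ratio:
  assumes t: "0 < t" and h: "hook_at t \<nu> a \<rho>" and ba: "b \<le> a" "b mod int t = a mod int t"
    and low: "\<And>k. k \<le> b \<Longrightarrow> k \<in> beads \<nu>"
  shows "of_nat t * (G t \<rho> / G t \<nu>) =
    bead_weight t b {s \<in> beads \<nu>. b \<le> s \<and> s mod int t = a mod int t} a"
proof -
  define B where "B = {s \<in> beads \<nu>. b \<le> s} - {a}"
  define R where "R = {s \<in> beads \<nu>. b \<le> s \<and> s mod int t = a mod int t}"
  note w = hook_at_window[OF h ba(1), folded B_def]
  have fin: "finite B" "finite R"
    unfolding B_def R_def by (auto intro: finite_subset[OF _ finite_beads_ge[of \<nu> b]])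
  have aB: "a \<notin> B"
    by (simp add: B_def)
  have low': "k < b \<Longrightarrow> k \<in> beads \<nu>" "k < b \<Longrightarrow> k \<in> beads \<rho>" for k
    using hook_at_low[OF h ba(1)] low by simp_all
  \<comment> \<open>\<open>Q\<close> and \<open>\<Psi>\<close> are common to both partitions;
    \<open>X\<close> and \<open>Y\<close> are the pairs with the moving bead before and after the
    move.\<close>
  define Q where "Q = (\<Prod>(g, s) | g \<in> B \<and> s \<in> B \<and> g < s. hook_factor t (s - g))"
  define \<Psi> where "\<Psi> = (\<Prod>s\<in>B. \<Prod>x\<in>{1..s - b}. hook_factor t x)"
  define \<Phi> where "\<Phi> = (\<Prod>x\<in>{1..a - b}. hook_factor t x)"
  define X where "X = (\<Prod>l\<in>B. hook_factor t (a - l))"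
  define Y where "Y = (\<Prod>l\<in>B. hook_factor t (a + int t - l))"
  have dvd: "int t dvd a - b"
    using ba(2) by (metis mod_eq_dvd_iff)
  have e1: "1 / G t \<nu> * (Q * X) = \<Phi> * \<Psi>"
    using prod.bead_pairs_insert_window[where \<phi> = "hook_factor t", OF low'(1) w(1) fin(1) aB hook_factor_minus]
    by (simp add: G_hook_factor prod.hooks_eq_bead_pairs Q_def X_def \<Phi>_def \<Psi>_def)
  have "1 / G t \<rho> * (Q * Y) = (\<Prod>x\<in>{1..a + int t - b}. hook_factor t x) * \<Psi>"
    using prod.bead_pairs_insert_window[where \<phi> = "hook_factor t", OF low'(2) w(2) fin(1) w(3) hook_factor_minus]
    by (simp add: G_hook_factor prod.hooks_eq_bead_pairs Q_def Y_def \<Psi>_def)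
  also have "a + int t - b = a - b + int t"
    by simp
  finally have e2: "1 / G t \<rho> * (Q * Y) = \<Phi> * of_int (a - b + int t) * \<Psi>"
    using prod_hook_factor_extend[OF t dvd] ba(1) by (simp add: \<Phi>_def)
  have nz: "Q \<noteq> 0" "X \<noteq> 0" "\<Phi> \<noteq> 0" "\<Psi> \<noteq> 0" "rat_of_int (a - b + int t) \<noteq> 0"
  proof -
    have "finite {(g, s). g \<in> B \<and> s \<in> B \<and> g < s}"
      by (rule finite_subset[of _ "B \<times> B"]) (use fin in auto)
    then show "Q \<noteq> 0"
      by (auto simp: Q_def)
    show "X \<noteq> 0" "\<Phi> \<noteq> 0" "\<Psi> \<noteq> 0"
      using fin aB by (auto simp: X_def \<Phi>_def \<Psi>_def)
    show "rat_of_int (a - b + int t) \<noteq> 0"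
      unfolding of_int_eq_0_iff using ba t by auto
  qed
  have "Y \<noteq> 0"
    using fin w(3) by (auto simp: Y_def)
  have g1: "G t \<nu> = Q * X / (\<Phi> * \<Psi>)"
    unfolding e1[symmetric] using nz by simp
  have g2: "G t \<rho> = Q * Y / (\<Phi> * of_int (a - b + int t) * \<Psi>)"
    unfolding e2[symmetric] using nz \<open>Y \<noteq> 0\<close> by simp
  have "G t \<rho> / G t \<nu> = Y / X / of_int (a - b + int t)"
    unfolding g1 g2 using nz by (simp del: of_int_add of_int_diff)
  also have "Y / X = (\<Prod>l\<in>B. hook_factor t (a + int t - l) / hook_factor t (a - l))"
    by (simp add: X_def Y_def prod_dividef)
  also have "\<dots> = (\<Prod>l\<in>B. if l mod int t = a mod int t then of_int (a + int t - l) / of_int (a - l) else 1)"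
  proof (rule prod.cong)
    fix l assume l: "l \<in> B"
    show "hook_factor t (a + int t - l) / hook_factor t (a - l) =
        (if l mod int t = a mod int t then of_int (a + int t - l) / of_int (a - l) else 1)"
    proof (cases "l mod int t = a mod int t")
      case True
      then show ?thesis
        using hook_factor_ratio[OF t True] l aB w(3) by (metis (full_types))
    next
      case False
      then have "\<not> int t dvd a - l" 
        by (metis mod_eq_dvd_iff)
      moreover from this have "\<not> int t dvd a + int t - l"
        by (metis add_diff_eq add.commute dvd_add_times_triv_left_iff mult_1 diff_add_eq)
      ultimately show ?thesis
        using False by (simp add: hook_factor_def)
    qed
  qed simp
  also have "\<dots> = (\<Prod>l\<in>R - {a}. of_int (a + int t - l) / of_int (a - l))"
  proof -
    have "R - {a} = {l \<in> B. l mod int t = a mod int t}"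
      by (auto simp: R_def B_def)
    then show ?thesis
      using fin(1) by (simp only: prod.inter_filter)
  qed
  also have "\<dots> = (\<Prod>l\<in>R - {a}. of_int (a + int t - l)) / (\<Prod>l\<in>R - {a}. of_int (a - l))"
    by (rule prod_dividef)
  finally have "of_nat t * (G t \<rho> / G t \<nu>) = of_nat t * (\<Prod>l\<in>R - {a}. of_int (a + int t - l)) /
      of_int (a - b + int t) / (\<Prod>l\<in>R - {a}. of_int (a - l))"
    by (simp add: field_simps)
  \<comment> \<open>The missing factor at \<open>l = a\<close> equals \<open>t\<close>; this
    explains the multiplier \<open>t\<close> in the statement.\<close>
  also have "of_nat t * (\<Prod>l\<in>R - {a}. of_int (a + int t - l)) = (\<Prod>l\<in>R. rat_of_int (a + int t - l))"
  proof -
    have "a \<in> R"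
      using h ba by (simp add: R_def hook_at_def)
    then show ?thesis
      by (subst prod.remove[OF fin(2), of a]) simp_all
  qed
  \<comment> \<open>The factor at \<open>l = b\<close> cancels against the one by which the window
    product has grown.\<close>
  also have "\<dots> = of_int (a - b + int t) * (\<Prod>l\<in>R - {b}. rat_of_int (a + int t - l))"
  proof -
    have "b \<in> R"
      using low[of b] ba by (simp add: R_def)
    then show ?thesis
      by (subst prod.remove[OF fin(2), of b]) (simp_all add: algebra_simps)
  qed
  finally show ?thesis
    using nz(5) by (simp add: bead_weight_def R_def)
qed

section \<open>Averages over the addable hooks and their moments\<close>

definition addable :: "nat \<Rightarrow> int_partition \<Rightarrow> int set" where
  "addable t \<nu> = {a \<in> beads \<nu>. a + int t \<notin> beads \<nu>}"

definition add_at :: "nat \<Rightarrow> int_partition \<Rightarrow> int \<Rightarrow> int_partition" where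
  "add_at t \<nu> a = (THE \<rho>. hook_at t \<nu> a \<rho>)"

lemma hook_at_add_at:
  assumes "0 < t" "a \<in> addable t \<nu>"
  shows "hook_at t \<nu> a (add_at t \<nu> a)"
proof -
  obtain \<rho> where "hook_at t \<nu> a \<rho>"
    using ex_hook_at[OF assms(1)] assms(2) by (auto simp: addable_def)
  then show ?thesis
    by (metis add_at_def the_equality hook_at_unique)
qed

lemma add_hook_eq_image:
  assumes "0 < t"
  shows "{\<rho>. add_hook t \<nu> \<rho>} = add_at t \<nu> ` addable t \<nu>"
proof (intro set_eqI iffI)
  fix \<rho> assume "\<rho> \<in> {\<rho>. add_hook t \<nu> \<rho>}"
  then obtain a where a: "hook_at t \<nu> a \<rho>"
    by (auto simp: add_hook_iff)
  then have "a \<in> addable t \<nu>"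
    by (simp add: hook_at_def addable_def)
  then show "\<rho> \<in> add_at t \<nu> ` addable t \<nu>"
    using hook_at_unique[OF a hook_at_add_at[OF assms]] by blast
next
  fix \<rho> assume "\<rho> \<in> add_at t \<nu> ` addable t \<nu>"
  then show "\<rho> \<in> {\<rho>. add_hook t \<nu> \<rho>}"
    using hook_at_add_at[OF assms] by (auto simp: add_hook_iff)
qed

lemma inj_on_add_at: "0 < t \<Longrightarrow> inj_on (add_at t \<nu>) (addable t \<nu>)"
  by (rule inj_onI) (metis hook_at_add_at hook_at_unique_pos)

lemma finite_addable: "finite (addable t \<nu>)"
proof -
  obtain N where N: "\<And>k. k \<le> N \<Longrightarrow> k \<in> beads \<nu>"
    using beads_low by blast
  have "addable t \<nu> \<subseteq> {N - int t..bead \<nu> 0}"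
  proof
    fix a assume "a \<in> addable t \<nu>"
    then have "a \<in> beads \<nu>" "\<not> a + int t \<le> N"
      using N by (auto simp: addable_def)
    then show "a \<in> {N - int t..bead \<nu> 0}"
      using beads_bounded_above[of a \<nu>] by auto
  qed
  then show ?thesis
    by (rule finite_subset) simp
qed

lemma finite_add_hook: "0 < t \<Longrightarrow> finite {\<rho>. add_hook t \<nu> \<rho>}"
  by (simp add: add_hook_eq_image finite_addable)

text \<open>By \<open>hook_mean_1\<close> the coefficients sum to 1, so this is a weighted average
  over the addable hooks.\<close>

definition hook_mean :: "nat \<Rightarrow> int_partition \<Rightarrow> (int \<Rightarrow> rat) \<Rightarrow> rat" where
  "hook_mean t \<nu> f = (\<Sum>a\<in>addable t \<nu>. G t (add_at t \<nu> a) / G t \<nu> * f a)"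

lemma hook_mean_zero [simp]: "hook_mean t \<nu> (\<lambda>_. 0) = 0"
  by (simp add: hook_mean_def)

lemma hook_mean_add: "hook_mean t \<nu> (\<lambda>a. f a + g a) = hook_mean t \<nu> f + hook_mean t \<nu> g"
  by (simp add: hook_mean_def sum.distrib distrib_left)

lemma hook_mean_cmult: "hook_mean t \<nu> (\<lambda>a. c * f a) = c * hook_mean t \<nu> f"
  by (simp add: hook_mean_def sum_distrib_left mult_ac)

lemma hook_mean_sum: "hook_mean t \<nu> (\<lambda>a. \<Sum>i\<in>I. f i a) = (\<Sum>i\<in>I. hook_mean t \<nu> (f i))"
  by (simp add: hook_mean_def sum_distrib_left sum.swap[of _ I])

lemma beads_low_mod:
  assumes "0 < t" "0 \<le> r" "r < int t"
  obtains b where "b < c" "b mod int t = r" "\<And>k. k \<le> b \<Longrightarrow> k \<in> beads \<nu>"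
proof -
  obtain N where N: "N \<le> c - 1" "\<And>k. k \<le> N \<Longrightarrow> k \<in> beads \<nu>"
    using beads_low_le by blast
  define b where "b = N - (N - r) mod int t"
  have "b \<le> N"
    using assms by (simp add: b_def)
  moreover have "b mod int t = r"
  proof -
    have "b mod int t = (N - (N - r)) mod int t"
      unfolding b_def by (rule mod_diff_right_eq)
    then show ?thesis
      using assms by simp
  qed
  ultimately show ?thesis
    using N by (intro that[of b]) auto
qed

text \<open>The sum over addable positions extends to all beads of the runner in the window, because
  \<open>bead_weight\<close> vanishes where the next position is occupied. Below \<open>b\<close>
  nothing is addable on this runner.\<close>

lemma hook_mean_runner:
  assumes t: "0 < t" and b: "b mod int t = r" and low: "\<And>k. k \<le> b \<Longrightarrow> k \<in> beads \<nu>"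
  defines "R \<equiv> {s \<in> beads \<nu>. b \<le> s \<and> s mod int t = r}"
  shows "of_nat t * hook_mean t \<nu> (\<lambda>a. if a mod int t = r then f a else 0) =
    (\<Sum>s\<in>R. bead_weight t b R s * f s)"
proof -
  have fin: "finite R"
    unfolding R_def by (rule finite_subset[OF _ finite_beads_ge[of \<nu> b]]) auto
  have ge: "b \<le> a" if "a \<in> addable t \<nu>" "a mod int t = r" for a
  proof (rule ccontr)
    assume "\<not> b \<le> a"
    moreover have "int t dvd b - a"
      using that b by (metis mod_eq_dvd_iff)
    ultimately have "int t \<le> b - a"
      by (intro zdvd_imp_le) auto
    then have "a + int t \<in> beads \<nu>"
      by (intro low) simp
    then show False
      using that by (simp add: addable_def)
  qed
  have "of_nat t * hook_mean t \<nu> (\<lambda>a. if a mod int t = r then f a else 0) =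
      (\<Sum>a\<in>addable t \<nu>. if a mod int t = r then bead_weight t b R a * f a else 0)"
    unfolding hook_mean_def sum_distrib_left
  proof (rule sum.cong)
    fix a assume a: "a \<in> addable t \<nu>"
    show "of_nat t * (G t (add_at t \<nu> a) / G t \<nu> * (if a mod int t = r then f a else 0)) =
        (if a mod int t = r then bead_weight t b R a * f a else 0)"
    proof (cases "a mod int t = r")
      case True
      then have "of_nat t * (G t (add_at t \<nu> a) / G t \<nu>) = bead_weight t b R a"
        using G_hook_at_ratio[OF t hook_at_add_at[OF t a] ge[OF a True] _ low] b by (simp add: R_def)
      from arg_cong[OF this, of "\<lambda>x. x * f a"] show ?thesis
        using True by (simp add: mult.assoc)
    qed simp
  qed simp
  also have "\<dots> = (\<Sum>a | a \<in> addable t \<nu> \<and> a mod int t = r. bead_weight t b R a * f a)"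
    by (simp add: sum.inter_filter finite_addable)
  also have "\<dots> = (\<Sum>s\<in>R. bead_weight t b R s * f s)"
  proof (rule sum.mono_neutral_left[OF fin])
    show "{a \<in> addable t \<nu>. a mod int t = r} \<subseteq> R"
      using ge by (auto simp: R_def addable_def)
    show "\<forall>s\<in>R - {a \<in> addable t \<nu>. a mod int t = r}. bead_weight t b R s * f s = 0"
    proof
      fix s assume s: "s \<in> R - {a \<in> addable t \<nu>. a mod int t = r}"
      then have "s + int t \<in> R"
        by (auto simp: R_def addable_def)
      moreover have "s + int t \<noteq> b"
        using s t by (auto simp: R_def)
      ultimately show "bead_weight t b R s * f s = 0"
        using bead_weight_0[OF fin] by simp
    qed
  qed
  finally show ?thesis .
qed

definition moment :: "nat \<Rightarrow> int \<Rightarrow> nat \<Rightarrow> int_partition \<Rightarrow> rat" where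
  "moment t r m \<nu> = hook_mean t \<nu> (\<lambda>a. if a mod int t = r then of_int a ^ m else 0)"

lemma moment_0:
  assumes "0 < t" "0 \<le> r" "r < int t"
  shows "of_nat t * moment t r 0 \<nu> = 1"
proof -
  obtain b where b: "b < 0" "b mod int t = r" "\<And>k. k \<le> b \<Longrightarrow> k \<in> beads \<nu>"
    using beads_low_mod[OF assms] by blast
  have fin: "finite {s \<in> beads \<nu>. b \<le> s \<and> s mod int t = r}"
    by (rule finite_subset[OF _ finite_beads_ge[of \<nu> b]]) auto
  show ?thesis
    using hook_mean_runner[OF assms(1) b(2,3), of "\<lambda>_. 1"] sum_bead_weight[OF fin, of b t] b
    by (simp add: moment_def cong: if_cong)
qed

text \<open>A move on another runner leaves the relevant beads alone. On the same runner,
  \<open>sum_bead_weight_mult\<close> fixes the first moment, and expanding the squares in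
  \<open>sum_bead_weight_move\<close> gives a recursion for the higher ones.\<close>

lemma moment_hook_at:
  assumes t: "0 < t" and r: "0 \<le> r" "r < int t" and h: "hook_at t \<nu> a \<rho>"
  shows "a mod int t \<noteq> r \<Longrightarrow> moment t r m \<rho> = moment t r m \<nu>"
    and "moment t r 1 \<rho> = moment t r 1 \<nu>"
    and "a mod int t = r \<Longrightarrow>
      moment t r (k + 2) \<rho> - 2 * of_int a * moment t r (k + 1) \<rho> +
        (of_int a ^ 2 - of_nat t ^ 2) * moment t r k \<rho> =
      moment t r (k + 2) \<nu> - 2 * of_int a * moment t r (k + 1) \<nu> + of_int a ^ 2 * moment t r k \<nu>"
proof -
  \<comment> \<open>Strictly below \<open>a\<close>, so that \<open>b\<close> is a bead of both
    partitions and differs from the moving bead.\<close>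
  obtain b where b: "b < a" "b mod int t = r" "\<And>k. k \<le> b \<Longrightarrow> k \<in> beads \<nu>"
    using beads_low_mod[OF t r] by blast
  define R where "R = {s \<in> beads \<nu>. b \<le> s \<and> s mod int t = r}"
  define R' where "R' = {s \<in> beads \<rho>. b \<le> s \<and> s mod int t = r}"
  have h': "a \<in> beads \<nu>" "a + int t \<notin> beads \<nu>" "beads \<rho> = insert (a + int t) (beads \<nu> - {a})"
    using h by (auto simp: hook_at_def)
  have low': "k \<in> beads \<rho>" if "k \<le> b" for k
    using b that h' by auto
  have fin: "finite R"
    unfolding R_def by (rule finite_subset[OF _ finite_beads_ge[of \<nu> b]]) auto
  have bR: "b \<in> R"
    using b by (simp add: R_def)
  have M: "of_nat t * moment t r m \<nu> = (\<Sum>s\<in>R. bead_weight t b R s * of_int s ^ m)"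
    "of_nat t * moment t r m \<rho> = (\<Sum>s\<in>R'. bead_weight t b R' s * of_int s ^ m)" for m
    unfolding moment_def R_def R'_def
    by (rule hook_mean_runner[OF t b(2) b(3)], assumption) (rule hook_mean_runner[OF t b(2) low'], assumption)
  have R'1: "R' = R" if "a mod int t \<noteq> r"
    using that b h' by (auto simp: R_def R'_def)
  have R'2: "R' = insert (a + int t) (R - {a})" "a \<in> R" "a + int t \<notin> R" if "a mod int t = r"
    using that b h' by (auto simp: R_def R'_def)
  have t0: "rat_of_nat t \<noteq> 0"
    using t by simp
  show other: "moment t r m \<rho> = moment t r m \<nu>" if "a mod int t \<noteq> r" for m
  proof -
    have "of_nat t * moment t r m \<rho> = of_nat t * moment t r m \<nu>"
      using M(1)[of m] M(2)[of m] unfolding R'1[OF that] by (rule trans[OF _ sym, rotated])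
    then show ?thesis
      using t0 by simp
  qed
  show "moment t r 1 \<rho> = moment t r 1 \<nu>"
  proof (cases "a mod int t = r")
    case True
    have card: "card R' = card R"
      using R'2[OF True] fin card.remove[of R a] by simp
    have "b \<in> R'"
      using b low' by (simp add: R'_def)
    have "finite R'"
      using R'2[OF True] fin by simp
    then have "of_nat t * moment t r 1 \<rho> = of_nat t * moment t r 1 \<nu>"
      unfolding M using \<open>b \<in> R'\<close> bR fin card by (simp add: sum_bead_weight_mult)
    then show ?thesis
      using t0 by simp
  qed (rule other)
  assume True: "a mod int t = r"
  have lin: "of_nat t * (moment t r (k + 2) \<sigma> - 2 * of_int a * moment t r (k + 1) \<sigma> + c * moment t r k \<sigma>) =
      (\<Sum>s\<in>S. bead_weight t b S s * (of_int s ^ 2 - 2 * of_int a * of_int s + c) * of_int s ^ k)"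
    if "\<And>m. of_nat t * moment t r m \<sigma> = (\<Sum>s\<in>S. bead_weight t b S s * of_int s ^ m)" for \<sigma> S c
  proof -
    have "of_nat t * (moment t r (k + 2) \<sigma> - 2 * of_int a * moment t r (k + 1) \<sigma> + c * moment t r k \<sigma>) =
        of_nat t * moment t r (k + 2) \<sigma> - 2 * of_int a * (of_nat t * moment t r (k + 1) \<sigma>) +
        c * (of_nat t * moment t r k \<sigma>)"
      by (simp add: algebra_simps)
    also have "\<dots> = (\<Sum>s\<in>S. bead_weight t b S s * (of_int s ^ 2 - 2 * of_int a * of_int s + c) * of_int s ^ k)"
      unfolding that sum_distrib_left sum_subtractf[symmetric] sum.distrib[symmetric]
      by (rule sum.cong) (simp_all add: algebra_simps power_add power2_eq_square)
    finally show ?thesis .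
  qed
  have sq: "rat_of_int s ^ 2 - 2 * of_int a * of_int s + (of_int a ^ 2 - of_nat t ^ 2) =
      of_int (s - a) ^ 2 - of_int (int t) ^ 2"
    "rat_of_int s ^ 2 - 2 * of_int a * of_int s + of_int a ^ 2 = of_int (s - a) ^ 2" for s
    by (simp_all add: power2_eq_square algebra_simps)
  have "of_nat t * (moment t r (k + 2) \<rho> - 2 * of_int a * moment t r (k + 1) \<rho> +
        (of_int a ^ 2 - of_nat t ^ 2) * moment t r k \<rho>) =
      of_nat t * (moment t r (k + 2) \<nu> - 2 * of_int a * moment t r (k + 1) \<nu> + of_int a ^ 2 * moment t r k \<nu>)"
    unfolding lin[OF M(1)] lin[OF M(2)] sq R'2(1)[OF True]
    using R'2[OF True] b by (intro sum_bead_weight_move[OF fin]) auto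
  then show "moment t r (k + 2) \<rho> - 2 * of_int a * moment t r (k + 1) \<rho> +
        (of_int a ^ 2 - of_nat t ^ 2) * moment t r k \<rho> =
      moment t r (k + 2) \<nu> - 2 * of_int a * moment t r (k + 1) \<nu> + of_int a ^ 2 * moment t r k \<nu>"
    using t0 by simp
qed

lemma hook_mean_residues:
  assumes "0 < t"
  shows "hook_mean t \<nu> (\<lambda>a. c (a mod int t) * of_int a ^ m) =
    (\<Sum>r\<in>{0..<int t}. c r * moment t r m \<nu>)"
proof -
  have "(\<lambda>a. c (a mod int t) * of_int a ^ m) =
      (\<lambda>a. \<Sum>r\<in>{0..<int t}. c r * (if a mod int t = r then of_int a ^ m else 0))"
  proof
    fix a
    have "(\<Sum>r\<in>{0..<int t}. c r * (if a mod int t = r then of_int a ^ m else 0)) =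
        (\<Sum>r\<in>{0..<int t}. if a mod int t = r then c (a mod int t) * of_int a ^ m else 0)"
      by (rule sum.cong) auto
    then show "c (a mod int t) * of_int a ^ m =
        (\<Sum>r\<in>{0..<int t}. c r * (if a mod int t = r then of_int a ^ m else 0))"
      using assms by simp
  qed
  then show ?thesis
    by (simp add: hook_mean_sum hook_mean_cmult moment_def)
qed

lemma hook_mean_1:
  assumes "0 < t"
  shows "hook_mean t \<nu> (\<lambda>_. 1) = 1"
proof -
  have "of_nat t * hook_mean t \<nu> (\<lambda>_. 1) = (\<Sum>r\<in>{0..<int t}. of_nat t * moment t r 0 \<nu>)"
    using hook_mean_residues[OF assms, of \<nu> "\<lambda>_. 1" 0] by (simp add: sum_distrib_left)
  also have "\<dots> = of_nat t"
    using assms by (simp add: moment_0)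
  finally show ?thesis
    using assms by simp
qed

text \<open>After division by \<open>G t \<nu>\<close>, the sum in \<open>D\<close> is the average
  of \<open>q \<nu> + \<phi> \<nu> a\<close>. Averaging preserves the constant
  \<open>q \<nu>\<close>, which the subtracted term then removes.\<close>

lemma D_G_mult:
  assumes "0 < t" and \<phi>: "\<And>\<nu> a \<rho>. hook_at t \<nu> a \<rho> \<Longrightarrow> q \<rho> - q \<nu> = \<phi> \<nu> a"
  shows "D t (\<lambda>\<nu>. G t \<nu> * q \<nu>) = (\<lambda>\<nu>. G t \<nu> * hook_mean t \<nu> (\<phi> \<nu>))"
proof
  fix \<nu>
  have "(\<Sum>\<rho> | add_hook t \<nu> \<rho>. G t \<rho> * q \<rho>) =
      (\<Sum>a\<in>addable t \<nu>. G t (add_at t \<nu> a) * q (add_at t \<nu> a))"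
    by (simp add: add_hook_eq_image[OF assms(1)] sum.reindex[OF inj_on_add_at[OF assms(1)]])
  also have "\<dots> = (\<Sum>a\<in>addable t \<nu>. G t \<nu> * (G t (add_at t \<nu> a) / G t \<nu> * (q \<nu> * 1 + \<phi> \<nu> a)))"
  proof (rule sum.cong)
    fix a assume "a \<in> addable t \<nu>"
    then have "q (add_at t \<nu> a) = q \<nu> * 1 + \<phi> \<nu> a"
      using \<phi>[OF hook_at_add_at[OF assms(1)]] by (simp add: algebra_simps)
    then show "G t (add_at t \<nu> a) * q (add_at t \<nu> a) =
        G t \<nu> * (G t (add_at t \<nu> a) / G t \<nu> * (q \<nu> * 1 + \<phi> \<nu> a))"
      by (simp add: G_nonzero)
  qed simp
  also have "\<dots> = G t \<nu> * hook_mean t \<nu> (\<lambda>a. q \<nu> * 1 + \<phi> \<nu> a)"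
    by (simp add: hook_mean_def sum_distrib_left)
  also have "\<dots> = G t \<nu> * (q \<nu> + hook_mean t \<nu> (\<phi> \<nu>))"
    unfolding hook_mean_add hook_mean_cmult by (simp add: hook_mean_1[OF assms(1)])
  finally show "D t (\<lambda>\<nu>. G t \<nu> * q \<nu>) \<nu> = G t \<nu> * hook_mean t \<nu> (\<phi> \<nu>)"
    by (simp add: D_def algebra_simps)
qed

section \<open>The weight filtration\<close>

text \<open>Functions and their differences refer to each other, so both are generated
  simultaneously. The drop by 2 in \<open>hook_filt_step\<close> matches the two steps lost under
  \<open>D\<close>. Functions invariant under adding hooks get every weight, and the residue factor
  \<open>c\<close> does not count towards the weight.\<close>

inductive hook_filt :: "nat \<Rightarrow> nat \<Rightarrow> (int_partition \<Rightarrow> rat) \<Rightarrow> bool"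
  and hook_diff :: "nat \<Rightarrow> nat \<Rightarrow> (int_partition \<Rightarrow> int \<Rightarrow> rat) \<Rightarrow> bool" for t
where
  hook_filt_flat: "(\<And>\<nu> a \<rho>. hook_at t \<nu> a \<rho> \<Longrightarrow> q \<rho> = q \<nu>) \<Longrightarrow> hook_filt t w q"
| hook_filt_step: "hook_diff t v \<phi> \<Longrightarrow> v + 2 \<le> w \<Longrightarrow>
    (\<And>\<nu> a \<rho>. hook_at t \<nu> a \<rho> \<Longrightarrow> q \<rho> - q \<nu> = \<phi> \<nu> a) \<Longrightarrow> hook_filt t w q"
| hook_diff_zero: "hook_diff t v (\<lambda>_ _. 0)"
| hook_diff_term: "hook_filt t w f \<Longrightarrow> w + m \<le> v \<Longrightarrow>
    hook_diff t v (\<lambda>\<nu> a. f \<nu> * c (a mod int t) * of_int a ^ m)"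
| hook_diff_add: "hook_diff t v \<phi> \<Longrightarrow> hook_diff t v \<psi> \<Longrightarrow> hook_diff t v (\<lambda>\<nu> a. \<phi> \<nu> a + \<psi> \<nu> a)"

lemmas hook_diff_induct [consumes 1, case_names flat step zero "term" add] =
  hook_filt_hook_diff.inducts(2)[where ?P1.0 = "\<lambda>_ _. True"]

lemma hook_diff_mono: "hook_diff t v \<phi> \<Longrightarrow> v \<le> v' \<Longrightarrow> hook_diff t v' \<phi>"
proof (induction v \<phi> arbitrary: v' rule: hook_diff_induct)
  case (add v \<phi> \<psi>)
  then show ?case by (intro hook_diff_add) auto
qed (auto intro: hook_diff_zero hook_diff_term)

lemma hook_filt_mono: "hook_filt t w q \<Longrightarrow> w \<le> w' \<Longrightarrow> hook_filt t w' q"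
  by (erule hook_filt.cases) (auto intro: hook_filt_flat hook_filt_step)

text \<open>Merges the two rules for \<open>hook_filt\<close>. Keeping the zero difference as a
  separate case avoids the truncated \<open>w - 2\<close>: for \<open>w < 2\<close> it is the only
  possibility.\<close>

lemma hook_filtE:
  assumes "hook_filt t w q"
  obtains \<phi> where "\<And>\<nu> a \<rho>. hook_at t \<nu> a \<rho> \<Longrightarrow> q \<rho> - q \<nu> = \<phi> \<nu> a"
    and "\<phi> = (\<lambda>_ _. 0) \<or> (2 \<le> w \<and> hook_diff t (w - 2) \<phi>)"
  using assms
proof (cases rule: hook_filt.cases)
  case hook_filt_flat
  then show ?thesis
    by (intro that[of "\<lambda>_ _. 0"]) auto
next
  case (hook_filt_step v \<phi>)
  then show ?thesis
    by (intro that[of \<phi>]) (auto intro: hook_diff_mono)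
qed

lemma hook_filtI:
  assumes "\<And>\<nu> a \<rho>. hook_at t \<nu> a \<rho> \<Longrightarrow> q \<rho> - q \<nu> = \<phi> \<nu> a"
    and "\<phi> = (\<lambda>_ _. 0) \<or> (2 \<le> w \<and> hook_diff t (w - 2) \<phi>)"
  shows "hook_filt t w q"
  using assms(2)
proof
  assume "\<phi> = (\<lambda>_ _. 0)"
  then show ?thesis
    using assms(1) by (intro hook_filt_flat) force
next
  assume "2 \<le> w \<and> hook_diff t (w - 2) \<phi>"
  then show ?thesis
    using assms(1) by (intro hook_filt_step[of t "w - 2" \<phi>]) auto
qed

lemma hook_filt_const: "hook_filt t w (\<lambda>_. c)"
  by (rule hook_filt_flat) simp

lemma hook_diff_cong: "hook_diff t v \<phi> \<Longrightarrow> (\<And>\<nu> a. \<phi> \<nu> a = \<psi> \<nu> a) \<Longrightarrow> hook_diff t v \<psi>"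
  by (metis ext)

lemma hook_diff_periodic_mult:
  "hook_diff t v \<phi> \<Longrightarrow> hook_diff t v (\<lambda>\<nu> a. c (a mod int t) * \<phi> \<nu> a)"
proof (induction v \<phi> rule: hook_diff_induct)
  case (add v \<phi> \<psi>)
  then show ?case
    using hook_diff_add by (fastforce simp: distrib_left)
next
  case ("term" w f m v c')
  then have "hook_diff t v (\<lambda>\<nu> a. f \<nu> * (\<lambda>x. c x * c' x) (a mod int t) * of_int a ^ m)"
    by (intro hook_diff_term)
  then show ?case
    by (rule hook_diff_cong) simp
qed (auto intro: hook_diff_zero)

lemma hook_diff_power_mult:
  "hook_diff t v \<phi> \<Longrightarrow> hook_diff t (v + k) (\<lambda>\<nu> a. of_int a ^ k * \<phi> \<nu> a)"
proof (induction v \<phi> rule: hook_diff_induct)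
  case (add v \<phi> \<psi>)
  show ?case
    by (rule hook_diff_cong[OF hook_diff_add[OF add.IH]]) (simp add: distrib_left)
next
  case ("term" w f m v c')
  then have "hook_diff t (v + k) (\<lambda>\<nu> a. f \<nu> * c' (a mod int t) * of_int a ^ (k + m))"
    by (intro hook_diff_term) auto
  then show ?case
    by (rule hook_diff_cong) (simp add: power_add)
qed (auto intro: hook_diff_zero)

lemma hook_diff_filt: "hook_filt t w f \<Longrightarrow> w \<le> v \<Longrightarrow> hook_diff t v (\<lambda>\<nu> _. f \<nu>)"
  using hook_diff_term[of t w f 0 v "\<lambda>_. 1"] by simp

text \<open>Closure under products appears as a premise, here and in
  \<open>hook_diff_mult_aux\<close>, since both serve inside the induction that proves
  \<open>hook_filt_mult\<close>, where it is known only for smaller total weight.\<close>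

lemma hook_diff_filt_mult:
  assumes "hook_diff t v \<phi>"
    and "\<And>u f. u \<le> v \<Longrightarrow> hook_filt t u f \<Longrightarrow> hook_filt t (u + w) (\<lambda>\<nu>. f \<nu> * q \<nu>)"
  shows "hook_diff t (v + w) (\<lambda>\<nu> a. \<phi> \<nu> a * q \<nu>)"
  using assms
proof (induction v \<phi> rule: hook_diff_induct)
  case (add v \<phi> \<psi>)
  show ?case
    by (rule hook_diff_cong[OF hook_diff_add[OF add.IH]]) (use add.prems in \<open>auto simp: distrib_right\<close>)
next
  case ("term" u f m v c)
  then have "hook_diff t (v + w) (\<lambda>\<nu> a. (f \<nu> * q \<nu>) * c (a mod int t) * of_int a ^ m)"
    by (intro hook_diff_term[of t "u + w"]) auto
  then show ?case
    by (rule hook_diff_cong) simp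
qed (auto intro: hook_diff_zero)

lemma hook_diff_mult_aux:
  assumes "hook_diff t v \<phi>" "hook_diff t v' \<phi>'"
    and "\<And>u f u' f'. u \<le> v \<Longrightarrow> u' \<le> v' \<Longrightarrow> hook_filt t u f \<Longrightarrow> hook_filt t u' f' \<Longrightarrow>
      hook_filt t (u + u') (\<lambda>\<nu>. f \<nu> * f' \<nu>)"
  shows "hook_diff t (v + v') (\<lambda>\<nu> a. \<phi> \<nu> a * \<phi>' \<nu> a)"
  using assms(1,3)
proof (induction v \<phi> rule: hook_diff_induct)
  case (add v \<phi> \<psi>)
  show ?case
    by (rule hook_diff_cong[OF hook_diff_add[OF add.IH]]) (use add.prems in \<open>auto simp: distrib_right\<close>)
next
  case ("term" u f m v c)
  have "hook_diff t (v' + u) (\<lambda>\<nu> a. \<phi>' \<nu> a * f \<nu>)"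
  proof (rule hook_diff_filt_mult[OF assms(2)])
    fix u' f' assume "u' \<le> v'" "hook_filt t u' f'"
    then have "hook_filt t (u + u') (\<lambda>\<nu>. f \<nu> * f' \<nu>)"
      using "term" by auto
    then show "hook_filt t (u' + u) (\<lambda>\<nu>. f' \<nu> * f \<nu>)"
      by (simp add: mult.commute add.commute)
  qed
  then have "hook_diff t (v' + u + m) (\<lambda>\<nu> a. of_int a ^ m * (c (a mod int t) * (\<phi>' \<nu> a * f \<nu>)))"
    by (intro hook_diff_power_mult hook_diff_periodic_mult)
  then have "hook_diff t (v + v') (\<lambda>\<nu> a. of_int a ^ m * (c (a mod int t) * (\<phi>' \<nu> a * f \<nu>)))"
    by (rule hook_diff_mono) (use "term" in simp)
  then show ?case
    by (rule hook_diff_cong) simp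
qed (auto intro: hook_diff_zero)

lemma hook_filt_add:
  assumes "hook_filt t w q" "hook_filt t w q'"
  shows "hook_filt t w (\<lambda>\<nu>. q \<nu> + q' \<nu>)"
proof -
  obtain \<phi> where \<phi>: "\<And>\<nu> a \<rho>. hook_at t \<nu> a \<rho> \<Longrightarrow> q \<rho> - q \<nu> = \<phi> \<nu> a"
    "\<phi> = (\<lambda>_ _. 0) \<or> (2 \<le> w \<and> hook_diff t (w - 2) \<phi>)"
    using hook_filtE[OF assms(1)] by blast
  obtain \<phi>' where \<phi>': "\<And>\<nu> a \<rho>. hook_at t \<nu> a \<rho> \<Longrightarrow> q' \<rho> - q' \<nu> = \<phi>' \<nu> a"
    "\<phi>' = (\<lambda>_ _. 0) \<or> (2 \<le> w \<and> hook_diff t (w - 2) \<phi>')"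
    using hook_filtE[OF assms(2)] by blast
  show ?thesis
  proof (rule hook_filtI)
    show "hook_at t \<nu> a \<rho> \<Longrightarrow> q \<rho> + q' \<rho> - (q \<nu> + q' \<nu>) = \<phi> \<nu> a + \<phi>' \<nu> a" for \<nu> a \<rho>
      using \<phi>(1)[of \<nu> a \<rho>] \<phi>'(1)[of \<nu> a \<rho>] by simp
    show "(\<lambda>\<nu> a. \<phi> \<nu> a + \<phi>' \<nu> a) = (\<lambda>_ _. 0) \<or>
        2 \<le> w \<and> hook_diff t (w - 2) (\<lambda>\<nu> a. \<phi> \<nu> a + \<phi>' \<nu> a)"
      using \<phi>(2) \<phi>'(2) by (auto intro: hook_diff_add)
  qed
qed

lemma hook_filt_sum: "(\<And>i. i \<in> I \<Longrightarrow> hook_filt t w (q i)) \<Longrightarrow> hook_filt t w (\<lambda>\<nu>. \<Sum>i\<in>I. q i \<nu>)"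
  by (induction I rule: infinite_finite_induct) (auto intro: hook_filt_const hook_filt_add)

text \<open>By the product rule for differences, every term of the change contains at least one
  difference. Its coefficient functions have lost weight 2, so the induction on
  \<open>w + w'\<close> covers their products.\<close>

lemma hook_filt_mult:
  assumes "hook_filt t w q" "hook_filt t w' q'"
  shows "hook_filt t (w + w') (\<lambda>\<nu>. q \<nu> * q' \<nu>)"
  using assms
proof (induction "w + w'" arbitrary: w w' q q' rule: less_induct)
  case less
  obtain \<phi> where \<phi>: "\<And>\<nu> a \<rho>. hook_at t \<nu> a \<rho> \<Longrightarrow> q \<rho> - q \<nu> = \<phi> \<nu> a"
    "\<phi> = (\<lambda>_ _. 0) \<or> (2 \<le> w \<and> hook_diff t (w - 2) \<phi>)"
    using hook_filtE[OF less.prems(1)] by blast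
  obtain \<phi>' where \<phi>': "\<And>\<nu> a \<rho>. hook_at t \<nu> a \<rho> \<Longrightarrow> q' \<rho> - q' \<nu> = \<phi>' \<nu> a"
    "\<phi>' = (\<lambda>_ _. 0) \<or> (2 \<le> w' \<and> hook_diff t (w' - 2) \<phi>')"
    using hook_filtE[OF less.prems(2)] by blast
  define \<psi> where "\<psi> \<nu> a = \<phi>' \<nu> a * q \<nu> + \<phi> \<nu> a * q' \<nu> + \<phi> \<nu> a * \<phi>' \<nu> a" for \<nu> a
  let ?n = "w + w' - 2"
  have 1: "hook_diff t ?n (\<lambda>\<nu> a. \<phi>' \<nu> a * q \<nu>)" if "2 \<le> w'" "hook_diff t (w' - 2) \<phi>'"
  proof -
    have "hook_diff t (w' - 2 + w) (\<lambda>\<nu> a. \<phi>' \<nu> a * q \<nu>)"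
      using that(1) less.prems(1) by (intro hook_diff_filt_mult[OF that(2)] less.hyps) auto
    then show ?thesis
      using that(1) by (rule_tac hook_diff_mono) auto
  qed
  have 2: "hook_diff t ?n (\<lambda>\<nu> a. \<phi> \<nu> a * q' \<nu>)" if "2 \<le> w" "hook_diff t (w - 2) \<phi>"
  proof -
    have "hook_diff t (w - 2 + w') (\<lambda>\<nu> a. \<phi> \<nu> a * q' \<nu>)"
      using that(1) less.prems(2) by (intro hook_diff_filt_mult[OF that(2)] less.hyps) auto
    then show ?thesis
      using that(1) by (rule_tac hook_diff_mono) auto
  qed
  have 3: "hook_diff t ?n (\<lambda>\<nu> a. \<phi> \<nu> a * \<phi>' \<nu> a)"
    if "2 \<le> w" "hook_diff t (w - 2) \<phi>" "2 \<le> w'" "hook_diff t (w' - 2) \<phi>'"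
  proof -
    have "hook_diff t (w - 2 + (w' - 2)) (\<lambda>\<nu> a. \<phi> \<nu> a * \<phi>' \<nu> a)"
      using that(1,3) by (intro hook_diff_mult_aux[OF that(2,4)] less.hyps) auto
    then show ?thesis
      using that(1,3) by (rule_tac hook_diff_mono) auto
  qed
  show ?case
  proof (rule hook_filtI)
    show "q \<rho> * q' \<rho> - q \<nu> * q' \<nu> = \<psi> \<nu> a" if "hook_at t \<nu> a \<rho>" for \<nu> a \<rho>
      unfolding \<psi>_def \<phi>(1)[OF that, symmetric] \<phi>'(1)[OF that, symmetric]
      by (simp add: algebra_simps)
    show "\<psi> = (\<lambda>_ _. 0) \<or> 2 \<le> w + w' \<and> hook_diff t ?n \<psi>"
    proof (cases "\<phi> = (\<lambda>_ _. 0)")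
      case True
      then show ?thesis
        using \<phi>'(2) 1 by (auto simp: \<psi>_def[abs_def])
    next
      case False
      then have f: "2 \<le> w" "hook_diff t (w - 2) \<phi>"
        using \<phi>(2) by auto
      show ?thesis
      proof (cases "\<phi>' = (\<lambda>_ _. 0)")
        case True
        then show ?thesis
          using f 2 by (auto simp: \<psi>_def[abs_def])
      next
        case False
        then have f': "2 \<le> w'" "hook_diff t (w' - 2) \<phi>'"
          using \<phi>'(2) by auto
        have "hook_diff t ?n \<psi>"
          unfolding \<psi>_def[abs_def]
          by (intro hook_diff_add 1[OF f'] 2[OF f] 3[OF f f'])
        then show ?thesis
          using f by simp
      qed
    qed
  qed
qed

text \<open>The recursion in \<open>moment_hook_at\<close> expresses the change of moment
  \<open>j + 2\<close> by \<open>a\<close> times the change of moment \<open>j + 1\<close>, by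
  \<open>a^2\<close> and constants times the change of moment \<open>j\<close>, and by moment
  \<open>j\<close> itself. Each of these has weight at most \<open>j\<close>.\<close>

lemma hook_filt_moment:
  assumes t: "0 < t" and r: "0 \<le> r" "r < int t"
  shows "hook_filt t k (moment t r k)"
proof (induction k rule: less_induct)
  case (less k)
  \<comment> \<open>The bound reads \<open>i + e \<le> m + 2\<close> instead of using
    \<open>i - 2\<close>, so that it also covers \<open>i < 2\<close>, where the change is
    zero.\<close>
  have *: "\<exists>\<phi>. (\<forall>\<nu> a \<rho>. hook_at t \<nu> a \<rho> \<longrightarrow> moment t r i \<rho> - moment t r i \<nu> = \<phi> \<nu> a) \<and>
      (\<forall>e m. i + e \<le> m + 2 \<longrightarrow> hook_diff t m (\<lambda>\<nu> a. of_int a ^ e * \<phi> \<nu> a))"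
    if i: "i < k" for i
  proof -
    obtain \<phi> where \<phi>: "\<And>\<nu> a \<rho>. hook_at t \<nu> a \<rho> \<Longrightarrow> moment t r i \<rho> - moment t r i \<nu> = \<phi> \<nu> a"
      "\<phi> = (\<lambda>_ _. 0) \<or> (2 \<le> i \<and> hook_diff t (i - 2) \<phi>)"
      using hook_filtE[OF less[OF i]] by blast
    have "hook_diff t m (\<lambda>\<nu> a. of_int a ^ e * \<phi> \<nu> a)" if "i + e \<le> m + 2" for e m
      using \<phi>(2)
    proof
      assume "2 \<le> i \<and> hook_diff t (i - 2) \<phi>"
      then show ?thesis
        using that by (intro hook_diff_mono[OF hook_diff_power_mult[of t "i - 2"]]) auto
    qed (simp add: hook_diff_zero)
    then show ?thesis
      using \<phi>(1) by blast
  qed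
  consider "k = 0" | "k = 1" | j where "k = j + 2"
    by (metis One_nat_def add_2_eq_Suc' not0_implies_Suc)
  then show ?case
  proof cases
    case 1
    have "moment t r 0 = (\<lambda>_. 1 / of_nat t)"
      using moment_0[OF assms] t by (auto simp: fun_eq_iff field_simps)
    then show ?thesis
      using 1 hook_filt_const by metis
  next
    case 2
    then show ?thesis
      using moment_hook_at(2)[OF assms] by (intro hook_filt_flat) simp
  next
    case (3 j)
    obtain \<phi> where \<phi>: "\<And>\<nu> a \<rho>. hook_at t \<nu> a \<rho> \<Longrightarrow> moment t r j \<rho> - moment t r j \<nu> = \<phi> \<nu> a"
      "\<And>e m. j + e \<le> m + 2 \<Longrightarrow> hook_diff t m (\<lambda>\<nu> a. of_int a ^ e * \<phi> \<nu> a)"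
      using *[of j] 3 by auto
    obtain \<psi> where \<psi>: "\<And>\<nu> a \<rho>. hook_at t \<nu> a \<rho> \<Longrightarrow> moment t r (j + 1) \<rho> - moment t r (j + 1) \<nu> = \<psi> \<nu> a"
      "\<And>e m. j + 1 + e \<le> m + 2 \<Longrightarrow> hook_diff t m (\<lambda>\<nu> a. of_int a ^ e * \<psi> \<nu> a)"
      using *[of "j + 1"] 3 by auto
    \<comment> \<open>Obtained by solving the recursion for the change of moment
      \<open>j + 2\<close> and replacing moment \<open>j\<close> of \<open>\<rho>\<close> by that of
      \<open>\<nu>\<close> plus its change \<open>\<phi>\<close>. The exponents 0, 1 and 2 are
      written out to fit the weight rules.\<close>
    define \<chi> where "\<chi> \<nu> a = (if a mod int t = r then 1 else 0) *
      ((2 * (of_int a ^ 1 * \<psi> \<nu> a) + (- 1) * (of_int a ^ 2 * \<phi> \<nu> a)) +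
       (of_nat t ^ 2 * (of_int a ^ 0 * \<phi> \<nu> a) + of_nat t ^ 2 * moment t r j \<nu>))" for \<nu> a
    have "hook_filt t j (moment t r j)"
      using less[of j] 3 by simp
    then have "hook_diff t j \<chi>"
      unfolding \<chi>_def[abs_def]
      by (intro hook_diff_periodic_mult[where c = "\<lambda>x. if x = r then 1 else 0"] hook_diff_add
          hook_diff_periodic_mult[where c = "\<lambda>_. 2"] hook_diff_periodic_mult[where c = "\<lambda>_. - 1"]
          hook_diff_periodic_mult[where c = "\<lambda>_. of_nat t ^ 2"] \<phi>(2) \<psi>(2) hook_diff_filt) auto
    moreover have "moment t r (j + 2) \<rho> - moment t r (j + 2) \<nu> = \<chi> \<nu> a" if "hook_at t \<nu> a \<rho>" for \<nu> a \<rho>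
    proof (cases "a mod int t = r")
      case True
      show ?thesis
        using moment_hook_at(3)[OF assms that True, of j] True
        unfolding \<chi>_def \<phi>(1)[OF that, symmetric] \<psi>(1)[OF that, symmetric]
        by (simp add: algebra_simps)
    next
      case False
      then show ?thesis
        using moment_hook_at(1)[OF assms that False] by (simp add: \<chi>_def)
    qed
    ultimately show ?thesis
      unfolding 3 by (intro hook_filt_step[of t j \<chi>]) auto
  qed
qed


text \<open>Averaging turns \<open>a ^ m\<close> into moments of weight \<open>m\<close>, so the
  weight is preserved.\<close>

lemma hook_filt_mean:
  assumes t: "0 < t"
  shows "hook_diff t v \<phi> \<Longrightarrow> hook_filt t v (\<lambda>\<nu>. hook_mean t \<nu> (\<phi> \<nu>))"
proof (induction v \<phi> rule: hook_diff_induct)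
  case ("term" w f m v c)
  have "hook_filt t m (\<lambda>\<nu>. \<Sum>r\<in>{0..<int t}. c r * moment t r m \<nu>)"
    using hook_filt_mult[OF hook_filt_const[of t 0] hook_filt_moment[OF t]]
    by (intro hook_filt_sum) auto
  then have "hook_filt t (w + m) (\<lambda>\<nu>. f \<nu> * (\<Sum>r\<in>{0..<int t}. c r * moment t r m \<nu>))"
    by (intro hook_filt_mult "term")
  then have "hook_filt t (w + m) (\<lambda>\<nu>. hook_mean t \<nu> (\<lambda>a. f \<nu> * c (a mod int t) * of_int a ^ m))"
    by (simp add: mult.assoc hook_mean_cmult hook_mean_residues[OF t])
  then show ?case
    by (rule hook_filt_mono) (rule "term")
next
  case (add v \<phi> \<psi>)
  then show ?case
    by (simp add: hook_mean_add hook_filt_add)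
qed (auto intro: hook_filt_const)

section \<open>Nilpotency of \<open>D\<close>\<close>

lemma D_zero: "(D t ^^ n) (\<lambda>_. 0) = (\<lambda>_. 0)"
  by (induction n) (auto simp: D_def)

text \<open>One application of \<open>D\<close> replaces \<open>q\<close> by the average of its
  change, which has weight \<open>w - 2\<close>; below weight 2 the change is zero.\<close>

lemma D_nilpotent:
  assumes t: "0 < t"
  shows "hook_filt t w q \<Longrightarrow> w < 2 * n \<Longrightarrow> (D t ^^ n) (\<lambda>\<nu>. G t \<nu> * q \<nu>) = (\<lambda>_. 0)"
proof (induction n arbitrary: w q)
  case (Suc n)
  obtain \<phi> where \<phi>: "\<And>\<nu> a \<rho>. hook_at t \<nu> a \<rho> \<Longrightarrow> q \<rho> - q \<nu> = \<phi> \<nu> a"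
    "\<phi> = (\<lambda>_ _. 0) \<or> (2 \<le> w \<and> hook_diff t (w - 2) \<phi>)"
    using hook_filtE[OF Suc.prems(1)] by blast
  have step: "(D t ^^ Suc n) (\<lambda>\<nu>. G t \<nu> * q \<nu>) = (D t ^^ n) (\<lambda>\<nu>. G t \<nu> * hook_mean t \<nu> (\<phi> \<nu>))"
    unfolding funpow_Suc_right o_def using D_G_mult[OF t, of q \<phi>] \<phi>(1) by simp
  show ?case
    using \<phi>(2)
  proof
    assume "\<phi> = (\<lambda>_ _. 0)"
    then show ?thesis
      using step by (simp add: D_zero)
  next
    assume "2 \<le> w \<and> hook_diff t (w - 2) \<phi>"
    then show ?thesis
      unfolding step using Suc.prems(2) by (intro Suc.IH[OF hook_filt_mean[OF t]]) auto
  qed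
qed simp

section \<open>Hook and content sums have some finite weight\<close>

definition hook_poly :: "nat \<Rightarrow> (int_partition \<Rightarrow> rat) \<Rightarrow> bool" where
  "hook_poly t q \<longleftrightarrow> (\<exists>w. hook_filt t w q)"

definition hook_diff_poly :: "nat \<Rightarrow> (int_partition \<Rightarrow> int \<Rightarrow> rat) \<Rightarrow> bool" where
  "hook_diff_poly t \<phi> \<longleftrightarrow> (\<exists>v. hook_diff t v \<phi>)"

lemma hook_polyI:
  assumes "hook_diff_poly t \<phi>" "\<And>\<nu> a \<rho>. hook_at t \<nu> a \<rho> \<Longrightarrow> q \<rho> - q \<nu> = \<phi> \<nu> a"
  shows "hook_poly t q"
  using assms hook_filt_step unfolding hook_poly_def hook_diff_poly_def by blast

lemma hook_poly_const: "hook_poly t (\<lambda>_. c)"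
  unfolding hook_poly_def using hook_filt_const by blast

lemma hook_poly_mult: "hook_poly t q \<Longrightarrow> hook_poly t q' \<Longrightarrow> hook_poly t (\<lambda>\<nu>. q \<nu> * q' \<nu>)"
  unfolding hook_poly_def using hook_filt_mult by blast

lemma hook_poly_prod: "(\<And>i. i \<in> I \<Longrightarrow> hook_poly t (q i)) \<Longrightarrow> hook_poly t (\<lambda>\<nu>. \<Prod>i\<in>I. q i \<nu>)"
  by (induction I rule: infinite_finite_induct) (auto intro: hook_poly_mult hook_poly_const)

lemma hook_diff_poly_filt: "hook_poly t f \<Longrightarrow> hook_diff_poly t (\<lambda>\<nu> _. f \<nu>)"
  unfolding hook_poly_def hook_diff_poly_def using hook_diff_filt by blast

lemma hook_diff_poly_const: "hook_diff_poly t (\<lambda>_ _. c)"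
  by (intro hook_diff_poly_filt hook_poly_const)

lemma hook_diff_poly_add:
  assumes "hook_diff_poly t \<phi>" "hook_diff_poly t \<psi>"
  shows "hook_diff_poly t (\<lambda>\<nu> a. \<phi> \<nu> a + \<psi> \<nu> a)"
proof -
  obtain v v' where "hook_diff t v \<phi>" "hook_diff t v' \<psi>"
    using assms by (auto simp: hook_diff_poly_def)
  then have "hook_diff t (max v v') (\<lambda>\<nu> a. \<phi> \<nu> a + \<psi> \<nu> a)"
    by (intro hook_diff_add) (auto intro: hook_diff_mono)
  then show ?thesis
    by (auto simp: hook_diff_poly_def)
qed

lemma hook_diff_poly_mult:
  assumes "hook_diff_poly t \<phi>" "hook_diff_poly t \<psi>"
  shows "hook_diff_poly t (\<lambda>\<nu> a. \<phi> \<nu> a * \<psi> \<nu> a)"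
  using assms hook_diff_mult_aux[OF _ _ hook_filt_mult] unfolding hook_diff_poly_def by blast

lemma hook_diff_poly_diff:
  assumes "hook_diff_poly t \<phi>" "hook_diff_poly t \<psi>"
  shows "hook_diff_poly t (\<lambda>\<nu> a. \<phi> \<nu> a - \<psi> \<nu> a)"
  using hook_diff_poly_add[OF assms(1) hook_diff_poly_mult[OF hook_diff_poly_const[of t "- 1"] assms(2)]]
  by simp

lemma hook_diff_poly_sum:
  "(\<And>i. i \<in> I \<Longrightarrow> hook_diff_poly t (\<phi> i)) \<Longrightarrow> hook_diff_poly t (\<lambda>\<nu> a. \<Sum>i\<in>I. \<phi> i \<nu> a)"
  by (induction I rule: infinite_finite_induct) (auto intro: hook_diff_poly_add hook_diff_poly_const)

lemma hook_diff_poly_power: "hook_diff_poly t \<phi> \<Longrightarrow> hook_diff_poly t (\<lambda>\<nu> a. \<phi> \<nu> a ^ n)"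
  by (induction n) (auto intro: hook_diff_poly_mult hook_diff_poly_const)

lemma hook_diff_poly_periodic: "hook_diff_poly t (\<lambda>_ a. c (a mod int t))"
proof -
  have "hook_diff t 0 (\<lambda>\<nu> a. (\<lambda>_. 1) \<nu> * c (a mod int t) * of_int a ^ 0)"
    by (rule hook_diff_term[OF hook_filt_const]) simp
  then show ?thesis
    by (auto simp: hook_diff_poly_def)
qed

lemma hook_diff_poly_shift_mod: "hook_diff_poly t (\<lambda>_ a. c ((a + d) mod int t))"
  using hook_diff_poly_periodic[of t "\<lambda>x. c ((x + d) mod int t)"] by (simp add: mod_add_left_eq)

lemma hook_diff_poly_shift: "hook_diff_poly t (\<lambda>_ a. of_int (a + d))"
proof -
  have "hook_diff t 1 (\<lambda>\<nu> a. (\<lambda>_. 1) \<nu> * (\<lambda>_. 1) (a mod int t) * of_int a ^ 1)"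
    by (rule hook_diff_term[OF hook_filt_const]) simp
  then have "hook_diff_poly t (\<lambda>_ a. of_int a)"
    by (auto simp: hook_diff_poly_def)
  from hook_diff_poly_add[OF this hook_diff_poly_const[of t "of_int d"]] show ?thesis
    by simp
qed

lemmas hook_diff_poly_intros =
  hook_diff_poly_const hook_diff_poly_add hook_diff_poly_diff hook_diff_poly_mult hook_diff_poly_sum
  hook_diff_poly_power hook_diff_poly_shift_mod hook_diff_poly_shift hook_diff_poly_filt

lemma hook_poly_bead_sum:
  "hook_poly t (\<lambda>\<nu>. bead_sum \<nu> (\<lambda>i. if i mod int t = r then of_int i ^ n else 0))"
proof (rule hook_polyI)
  define c where "c x = (if x = r then 1 else 0 :: rat)" for x
  \<comment> \<open>The summand \<open>a + 0\<close> gives the second term the shape of the rules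
    for shifted positions.\<close>
  show "hook_diff_poly t (\<lambda>_ a. c ((a + int t) mod int t) * of_int (a + int t) ^ n -
      c ((a + 0) mod int t) * of_int (a + 0) ^ n)"
    by (intro hook_diff_poly_intros)
  show "hook_at t \<nu> a \<rho> \<Longrightarrow>
      bead_sum \<rho> (\<lambda>i. if i mod int t = r then of_int i ^ n else 0) -
      bead_sum \<nu> (\<lambda>i. if i mod int t = r then of_int i ^ n else 0) =
      c ((a + int t) mod int t) * of_int (a + int t) ^ n - c ((a + 0) mod int t) * of_int (a + 0) ^ n"
    for \<nu> a \<rho>
    by (subst bead_sum_hook_at) (auto simp: c_def)
qed

lemma bead_sum_diff: "bead_sum \<nu> (\<lambda>i. f i - g i) = bead_sum \<nu> f - bead_sum \<nu> g"
  by (simp add: bead_sum_def sum_subtractf)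

lemma bead_sum_cmult: "bead_sum \<nu> (\<lambda>i. c * f i) = c * bead_sum \<nu> f"
  by (simp add: bead_sum_def sum_distrib_left right_diff_distrib)

lemma bead_sum_sum: "bead_sum \<nu> (\<lambda>i. \<Sum>j\<in>J. f j i) = (\<Sum>j\<in>J. bead_sum \<nu> (f j))"
  by (simp add: bead_sum_def sum_subtractf sum.swap[of _ J])

text \<open>One factor \<open>a + d - i\<close> is split into \<open>a + d\<close>, which leaves the
  bead sum, and \<open>i\<close>, which increases \<open>l\<close>. When no such factor is left,
  sorting the beads by residue detaches \<open>c\<close> from the sum.\<close>

lemma hook_diff_poly_bead_sum:
  assumes t: "0 < t"
  shows "hook_diff_poly t
    (\<lambda>\<nu> a. bead_sum \<nu> (\<lambda>i. c ((a + d - i) mod int t) * of_int (a + d - i) ^ n * of_int i ^ l))"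
proof (induction n arbitrary: l)
  case 0
  have "bead_sum \<nu> (\<lambda>i. c ((a + d - i) mod int t) * of_int (a + d - i) ^ 0 * of_int i ^ l) =
      (\<Sum>r\<in>{0..<int t}. c ((a + (d - r)) mod int t) *
        bead_sum \<nu> (\<lambda>i. if i mod int t = r then of_int i ^ l else 0))" for \<nu> a
  proof -
    have "c ((a + d - i) mod int t) * of_int (a + d - i) ^ 0 * of_int i ^ l =
        (\<Sum>r\<in>{0..<int t}. c ((a + (d - r)) mod int t) * (if i mod int t = r then of_int i ^ l else 0))" for i
    proof -
      have "(\<Sum>r\<in>{0..<int t}. c ((a + (d - r)) mod int t) * (if i mod int t = r then of_int i ^ l else 0)) =
          (\<Sum>r\<in>{0..<int t}. if r = i mod int t then c ((a + (d - i mod int t)) mod int t) * of_int i ^ l else 0)"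
        by (rule sum.cong) auto
      also have "\<dots> = c ((a + d - i mod int t) mod int t) * of_int i ^ l"
        using t by (simp add: add_diff_eq)
      also have "(a + d - i mod int t) mod int t = (a + d - i) mod int t"
        by (rule mod_diff_right_eq)
      finally show ?thesis
        by simp
    qed
    then show ?thesis
      by (simp add: bead_sum_sum bead_sum_cmult)
  qed
  then show ?case
    by (simp only:) (intro hook_diff_poly_intros hook_poly_bead_sum)
next
  case (Suc n)
  have "bead_sum \<nu> (\<lambda>i. c ((a + d - i) mod int t) * of_int (a + d - i) ^ Suc n * of_int i ^ l) =
      of_int (a + d) * bead_sum \<nu> (\<lambda>i. c ((a + d - i) mod int t) * of_int (a + d - i) ^ n * of_int i ^ l) -
      bead_sum \<nu> (\<lambda>i. c ((a + d - i) mod int t) * of_int (a + d - i) ^ n * of_int i ^ Suc l)" for \<nu> a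
    unfolding bead_sum_cmult[symmetric] bead_sum_diff[symmetric]
    by (rule arg_cong[of _ _ "bead_sum \<nu>"]) (simp add: fun_eq_iff algebra_simps)
  then show ?case
    by (simp only:) (intro hook_diff_poly_intros Suc)
qed

text \<open>The symmetry of \<open>c\<close> and the even exponent make the summand an even
  function, so its change is given by \<open>hook_at_hook_sum\<close>; expanding the powers leaves
  only bead sums of known type.\<close>

lemma hook_poly_hook_sum:
  assumes t: "0 < t" and c: "\<And>x. c (- x mod int t) = c (x mod int t)"
  shows "hook_poly t (\<lambda>\<nu>. \<Sum>b\<in>boxes \<nu>. c (int (hook_length \<nu> b) mod int t) * of_nat (hook_length \<nu> b) ^ (2 * k))"
proof (rule hook_polyI)
  define f where "f x = c (x mod int t) * of_int x ^ (2 * k)" for x :: int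
  have "hook_diff_poly t (\<lambda>\<nu> a. f (int t) - f 0 + (\<Sum>d\<in>{1..int t}. f (a + d)) -
      (bead_sum \<nu> (\<lambda>i. c ((a + int t - i) mod int t) * of_int (a + int t - i) ^ (2 * k) * of_int i ^ 0) -
       bead_sum \<nu> (\<lambda>i. c ((a + 0 - i) mod int t) * of_int (a + 0 - i) ^ (2 * k) * of_int i ^ 0)))"
    unfolding f_def by (intro hook_diff_poly_intros hook_diff_poly_bead_sum t)
  also have "(\<lambda>\<nu> a. f (int t) - f 0 + (\<Sum>d\<in>{1..int t}. f (a + d)) -
      (bead_sum \<nu> (\<lambda>i. c ((a + int t - i) mod int t) * of_int (a + int t - i) ^ (2 * k) * of_int i ^ 0) -
       bead_sum \<nu> (\<lambda>i. c ((a + 0 - i) mod int t) * of_int (a + 0 - i) ^ (2 * k) * of_int i ^ 0))) =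
    (\<lambda>\<nu> a. f (int t) - f 0 + (\<Sum>d\<in>{1..int t}. f (a + d)) - bead_sum \<nu> (\<lambda>i. f (a - i + int t) - f (a - i)))"
    by (simp add: f_def bead_sum_diff algebra_simps)
  finally show "hook_diff_poly t (\<lambda>\<nu> a. f (int t) - f 0 + (\<Sum>d\<in>{1..int t}. f (a + d)) -
      bead_sum \<nu> (\<lambda>i. f (a - i + int t) - f (a - i)))" .
  fix \<nu> a \<rho> assume h: "hook_at t \<nu> a \<rho>"
  have "f (- x) = f x" for x
    by (simp add: f_def c)
  from hook_at_hook_sum[OF h, of f, OF this]
  show "(\<Sum>b\<in>boxes \<rho>. c (int (hook_length \<rho> b) mod int t) * of_nat (hook_length \<rho> b) ^ (2 * k)) -
      (\<Sum>b\<in>boxes \<nu>. c (int (hook_length \<nu> b) mod int t) * of_nat (hook_length \<nu> b) ^ (2 * k)) =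
      f (int t) - f 0 + (\<Sum>d\<in>{1..int t}. f (a + d)) - bead_sum \<nu> (\<lambda>i. f (a - i + int t) - f (a - i))"
    by (simp add: f_def)
qed

lemma hook_poly_content_sum:
  "hook_poly t (\<lambda>\<nu>. \<Sum>b\<in>boxes \<nu>. c (box_content b mod int t) * of_int (box_content b) ^ k)"
proof (rule hook_polyI)
  show "hook_diff_poly t (\<lambda>\<nu> a. \<Sum>d\<in>{1..int t}. c ((a + d) mod int t) * of_int (a + d) ^ k)"
    by (intro hook_diff_poly_intros)
  fix \<nu> a \<rho> assume h: "hook_at t \<nu> a \<rho>"
  have "(\<Sum>x\<in>{a + 1..a + int t}. c (x mod int t) * of_int x ^ k) =
      (\<Sum>d\<in>{1..int t}. c ((a + d) mod int t) * of_int (a + d) ^ k)"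
    by (rule sum.reindex_bij_witness[of _ "\<lambda>d. a + d" "\<lambda>x. x - a"]) auto
  then show "(\<Sum>b\<in>boxes \<rho>. c (box_content b mod int t) * of_int (box_content b) ^ k) -
      (\<Sum>b\<in>boxes \<nu>. c (box_content b mod int t) * of_int (box_content b) ^ k) =
      (\<Sum>d\<in>{1..int t}. c ((a + d) mod int t) * of_int (a + d) ^ k)"
    using hook_at_content_sum[OF h, of "\<lambda>x. c (x mod int t) * of_int x ^ k"] by simp
qed

text \<open>Taking both residues \<open>j\<close> and \<open>- j\<close> makes the indicator
  symmetric, as \<open>hook_poly_hook_sum\<close> requires.\<close>

lemma hook_poly_hook_class_sum:
  assumes t: "0 < t"
  shows "hook_poly t (\<lambda>\<nu>. \<Sum>b | b \<in> boxes \<nu> \<and>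
      ([int (hook_length \<nu> b) = j] (mod int t) \<or> [int (hook_length \<nu> b) = - j] (mod int t)).
      of_nat (hook_length \<nu> b) ^ (2 * k))"
proof -
  define c where "c x = (if x = j mod int t \<or> x = - j mod int t then 1 else 0 :: rat)" for x
  have "c (- x mod int t) = c (x mod int t)" for x
  proof -
    have "- x mod int t = j mod int t \<longleftrightarrow> x mod int t = - j mod int t"
      "- x mod int t = - j mod int t \<longleftrightarrow> x mod int t = j mod int t"
      by (metis add.inverse_inverse mod_minus_cong)+
    then show ?thesis
      by (auto simp: c_def)
  qed
  from hook_poly_hook_sum[OF t, of c k, OF this] show ?thesis
    by (simp add: sum.inter_filter finite_boxes c_def cong_def if_distrib[of "\<lambda>x. x * _"] cong: if_cong)
qed

lemma hook_poly_content_class_sum: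
  "hook_poly t (\<lambda>\<nu>. \<Sum>b | b \<in> boxes \<nu> \<and> [box_content b = j] (mod int t). of_int (box_content b) ^ k)"
  using hook_poly_content_sum[of t "\<lambda>x. if x = j mod int t then 1 else 0" k]
  by (simp add: sum.inter_filter finite_boxes cong_def if_distrib[of "\<lambda>x. x * _"] cong: if_cong)

section \<open>Cores and levels\<close>

lemma hook_ge_refl: "hook_ge t \<nu> \<nu>"
  by (simp add: hook_ge_def)

lemma hook_ge_step: "hook_ge t \<rho> \<mu> \<Longrightarrow> add_hook t \<rho> \<nu> \<Longrightarrow> hook_ge t \<nu> \<mu>"
  unfolding hook_ge_def by (rule rtranclp.rtrancl_into_rtrancl)

lemma hook_ge_psize:
  assumes "0 < t"
  shows "hook_ge t \<nu> \<mu> \<Longrightarrow> psize \<mu> \<le> psize \<nu> \<and> (psize \<mu> = psize \<nu> \<longrightarrow> \<mu> = \<nu>)"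
  unfolding hook_ge_def
proof (induction rule: rtranclp_induct)
  case (step \<rho> \<nu>)
  then show ?case
    using psize_add_hook[OF step.hyps(2)] assms by simp
qed simp

text \<open>Every hook adds \<open>t\<close> boxes, so a chain that adds only \<open>t\<close> boxes
  has length one. This identifies the predecessors in the recursion for \<open>F\<close>.\<close>

lemma hook_ge_psize_iff:
  assumes "0 < t"
  shows "hook_ge t \<nu> \<rho> \<and> psize \<nu> = psize \<rho> + t \<longleftrightarrow> add_hook t \<rho> \<nu>"
proof
  assume asm: "hook_ge t \<nu> \<rho> \<and> psize \<nu> = psize \<rho> + t"
  then have "(add_hook t)\<^sup>*\<^sup>* \<rho> \<nu>"
    by (simp add: hook_ge_def)
  then show "add_hook t \<rho> \<nu>"
  proof (cases rule: converse_rtranclpE)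
    case base
    then show ?thesis using asm assms by simp
  next
    case (step \<sigma>)
    then have "psize \<sigma> = psize \<nu>" "hook_ge t \<nu> \<sigma>"
      using asm psize_add_hook by (auto simp: hook_ge_def)
    then have "\<sigma> = \<nu>"
      using hook_ge_psize[OF assms] by blast
    then show ?thesis using step by simp
  qed
next
  assume "add_hook t \<rho> \<nu>"
  then show "hook_ge t \<nu> \<rho> \<and> psize \<nu> = psize \<rho> + t"
    using hook_ge_step[OF hook_ge_refl] psize_add_hook by blast
qed

text \<open>A removable hook is a gap at \<open>a\<close> with a bead at \<open>a + t\<close>, that
  is, a box of hook length \<open>t\<close>.\<close>

lemma core_no_removable_hook:
  assumes t: "0 < t" and core: "is_core t \<mu>"
  shows "\<not> add_hook t \<rho> \<mu>"
proof
  assume "add_hook t \<rho> \<mu>"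
  then obtain a where "hook_at t \<rho> a \<mu>"
    by (auto simp: add_hook_iff)
  then have "(a, a + int t) \<in> bead_pairs (beads \<mu>)"
    using t by (auto simp: hook_at_def bead_pairs_def)
  then have "(a, a + int t) \<in> (\<lambda>(i, j). (gap \<mu> j, bead \<mu> i)) ` boxes \<mu>"
    using bij_betw_boxes[of \<mu>] by (simp add: bij_betw_def)
  then obtain i j where ij: "(i, j) \<in> boxes \<mu>" "gap \<mu> j = a" "bead \<mu> i = a + int t"
    by auto
  then have "hook_length \<mu> (i, j) = t"
    using hook_length_eq[of j \<mu> i] by (simp add: boxes_def)
  then have "t \<in># hook_lengths \<mu>"
    using ij(1) finite_boxes[of \<mu>] by (auto simp: hook_lengths_def intro: rev_image_eqI)
  then show False
    using core unfolding is_core_def by (metis dvd_refl)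
qed

text \<open>The regularized number of beads on a runner. Moves stay on their runner, so it is an
  invariant and determines the core.\<close>

definition runner_charge :: "nat \<Rightarrow> int \<Rightarrow> int_partition \<Rightarrow> rat" where
  "runner_charge t r \<nu> = bead_sum \<nu> (\<lambda>i. if i mod int t = r then 1 else 0)"

lemma runner_charge_hook_ge: "hook_ge t \<nu> \<mu> \<Longrightarrow> runner_charge t r \<nu> = runner_charge t r \<mu>"
  unfolding hook_ge_def
proof (induction rule: rtranclp_induct)
  case (step \<rho> \<nu>)
  then obtain a where "hook_at t \<rho> a \<nu>"
    by (auto simp: add_hook_iff)
  from bead_sum_hook_at[OF this, of "\<lambda>i. if i mod int t = r then 1 else 0"] show ?case
    using step.IH by (simp add: runner_charge_def)
qed simp

text \<open>
  Without removable hooks the beads of each runner form an initial segment, and its end is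
  determined by the charge.
\<close>

lemma beads_subset_if_charge_eq:
  assumes t: "0 < t"
    and nr: "\<And>\<rho>. \<not> add_hook t \<rho> \<mu>" "\<And>\<rho>. \<not> add_hook t \<rho> \<mu>'"
    and charge: "\<And>r. runner_charge t r \<mu> = runner_charge t r \<mu>'"
  shows "beads \<mu> \<subseteq> beads \<mu>'"
proof
  fix k assume k: "k \<in> beads \<mu>"
  show "k \<in> beads \<mu>'"
  proof (rule ccontr)
    assume k': "k \<notin> beads \<mu>'"
    have down: "x \<in> beads \<sigma>" if "x + int t * int n \<in> beads \<sigma>" "\<And>\<rho>. \<not> add_hook t \<rho> \<sigma>" for x n \<sigma>
      using that(1)
    proof (induction n)
      case (Suc n)
      have "(x + int t * int n) + int t \<in> beads \<sigma>"
        using Suc.prems by (simp add: algebra_simps)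
      then have "x + int t * int n \<in> beads \<sigma>"
        using ex_hook_at_remove[OF t] that(2) unfolding add_hook_iff by blast
      then show ?case
        by (rule Suc.IH)
    qed simp
    have down': "x \<in> beads \<sigma>"
      if y: "y \<in> beads \<sigma>" "x \<le> y" "x mod int t = y mod int t"
        and \<sigma>: "\<And>\<rho>. \<not> add_hook t \<rho> \<sigma>" for x y \<sigma>
    proof -
      obtain q where q: "y - x = int t * q"
        using y(3) by (metis mod_eq_dvd_iff dvdE)
      then have "0 \<le> q"
        using y(2) t by (metis diff_ge_0_iff_ge of_nat_0_less_iff zero_le_mult_iff not_less)
      then have "x + int t * int (nat q) = y"
        using q by simp
      then show ?thesis
        using y(1) \<sigma> down[of x "nat q" \<sigma>] by simp
    qed
    obtain b1 where b1: "b1 \<le> min 0 k" "\<And>x. x \<le> b1 \<Longrightarrow> x \<in> beads \<mu>"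
      using beads_low_le by blast
    obtain b where b: "b \<le> b1" "\<And>x. x \<le> b \<Longrightarrow> x \<in> beads \<mu>'"
      using beads_low_le by blast
    have ch: "runner_charge t (k mod int t) \<sigma> =
        of_nat (card {s \<in> beads \<sigma>. b \<le> s \<and> s mod int t = k mod int t}) -
        (\<Sum>s\<in>{b..-1}. if s mod int t = k mod int t then 1 else 0)"
      if "\<And>x. x \<le> b \<Longrightarrow> x \<in> beads \<sigma>" for \<sigma>
    proof -
      have "(\<Sum>s | s \<in> beads \<sigma> \<and> b \<le> s. if s mod int t = k mod int t then 1 else 0 :: rat) =
          of_nat (card {s \<in> {s \<in> beads \<sigma>. b \<le> s}. s mod int t = k mod int t})"
        using finite_beads_ge[of \<sigma> b] by (simp add: sum.inter_filter[symmetric])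
      then show ?thesis
        using that b b1 unfolding runner_charge_def
        by (subst bead_sum_window[of b]) (auto simp: conj_assoc)
    qed
    let ?A = "{s \<in> beads \<mu>. b \<le> s \<and> s mod int t = k mod int t}"
    let ?A' = "{s \<in> beads \<mu>'. b \<le> s \<and> s mod int t = k mod int t}"
    \<comment> \<open>On this runner the beads of \<open>\<mu>'\<close> end before \<open>k\<close>,
      while those of \<open>\<mu>\<close> reach \<open>k\<close>. The bead counts in the common
      window therefore differ, against the equality of charges.\<close>
    have "?A' \<subset> ?A"
    proof (rule psubsetI)
      show "?A' \<subseteq> ?A"
      proof
        fix s assume s: "s \<in> ?A'"
        have "s < k"
          using s k' down'[of s \<mu>' k] nr(2) by (cases "s < k") auto
        then show "s \<in> ?A"
          using s down'[OF k _ _ nr(1), of s] by auto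
      qed
      show "?A' \<noteq> ?A"
        using k k' b b1 by auto
    qed
    moreover have "finite ?A"
      by (rule finite_subset[OF _ finite_beads_ge[of \<mu> b]]) auto
    ultimately have "card ?A' < card ?A"
      by (simp add: psubset_card_mono)
    moreover have "runner_charge t (k mod int t) \<mu> = runner_charge t (k mod int t) \<mu>'"
      by (rule charge)
    moreover have "x \<in> beads \<mu>" if "x \<le> b" for x
      using that b b1 by auto
    ultimately show False
      using ch[of \<mu>] ch[of \<mu>'] b(2) by simp
  qed
qed

lemma core_unique:
  assumes "0 < t" "hook_ge t \<nu> \<mu>" "hook_ge t \<nu> \<mu>'"
    and "\<not> (\<exists>\<rho>. add_hook t \<rho> \<mu>)" "\<not> (\<exists>\<rho>. add_hook t \<rho> \<mu>')"
  shows "\<mu> = \<mu>'"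
proof -
  have "runner_charge t r \<mu> = runner_charge t r \<mu>'" for r
    using runner_charge_hook_ge[OF assms(2), of r] runner_charge_hook_ge[OF assms(3), of r] by simp
  then have "beads \<mu> = beads \<mu>'"
    using beads_subset_if_charge_eq[OF assms(1)] assms(4,5) by (intro equalityI) auto
  then show ?thesis
    by (simp add: beads_inject)
qed

lemma core_exists:
  assumes "0 < t"
  shows "\<exists>\<mu>. hook_ge t \<nu> \<mu> \<and> \<not> (\<exists>\<rho>. add_hook t \<rho> \<mu>)"
proof (induction "psize \<nu>" arbitrary: \<nu> rule: less_induct)
  case less
  show ?case
  proof (cases "\<exists>\<rho>. add_hook t \<rho> \<nu>")
    case True
    then obtain \<rho> where \<rho>: "add_hook t \<rho> \<nu>" by blast
    then have "psize \<rho> < psize \<nu>"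
      using psize_add_hook[OF \<rho>] assms by simp
    then show ?thesis
      using less[of \<rho>] hook_ge_step[OF _ \<rho>] by blast
  next
    case False
    then show ?thesis
      using hook_ge_refl by blast
  qed
qed

lemma core_of_eq_iff:
  assumes t: "0 < t" and core: "is_core t \<mu>"
  shows "core_of t \<nu> = \<mu> \<longleftrightarrow> hook_ge t \<nu> \<mu>"
proof -
  have nr: "\<not> (\<exists>\<rho>. add_hook t \<rho> \<mu>)"
    using core_no_removable_hook[OF assms] by blast
  have "\<exists>!\<mu>. hook_ge t \<nu> \<mu> \<and> \<not> (\<exists>\<rho>. add_hook t \<rho> \<mu>)"
    using core_exists[OF t, of \<nu>] core_unique[OF t, of \<nu>] by blast
  from theI'[OF this] show ?thesis
    unfolding core_of_def[symmetric] using nr core_unique[OF t, of \<nu>] by blast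
qed

section \<open>Level sums and their binomial expansion\<close>

definition hook_level :: "nat \<Rightarrow> int_partition \<Rightarrow> nat \<Rightarrow> int_partition set" where
  "hook_level t \<mu> n = {\<nu>. hook_ge t \<nu> \<mu> \<and> psize \<nu> = psize \<mu> + n * t}"

lemma hook_level_0: "0 < t \<Longrightarrow> hook_level t \<mu> 0 = {\<mu>}"
  using hook_ge_psize[of t] hook_ge_refl by (fastforce simp: hook_level_def)

lemma hook_level_Suc:
  assumes "0 < t"
  shows "hook_level t \<mu> (Suc n) = (\<Union>\<rho>\<in>hook_level t \<mu> n. {\<nu>. add_hook t \<rho> \<nu>})"
proof (intro set_eqI iffI)
  fix \<nu> assume \<nu>: "\<nu> \<in> hook_level t \<mu> (Suc n)"
  then have "(add_hook t)\<^sup>*\<^sup>* \<mu> \<nu>" "\<mu> \<noteq> \<nu>"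
    using assms by (auto simp: hook_level_def hook_ge_def)
  then obtain \<rho> where "hook_ge t \<rho> \<mu>" "add_hook t \<rho> \<nu>"
    unfolding hook_ge_def by (metis rtranclp.cases)
  then show "\<nu> \<in> (\<Union>\<rho>\<in>hook_level t \<mu> n. {\<nu>. add_hook t \<rho> \<nu>})"
    using \<nu> psize_add_hook[of t \<rho> \<nu>] by (auto simp: hook_level_def)
next
  fix \<nu> assume "\<nu> \<in> (\<Union>\<rho>\<in>hook_level t \<mu> n. {\<nu>. add_hook t \<rho> \<nu>})"
  then show "\<nu> \<in> hook_level t \<mu> (Suc n)"
    using psize_add_hook hook_ge_step by (fastforce simp: hook_level_def)
qed

lemma finite_hook_level: "0 < t \<Longrightarrow> finite (hook_level t \<mu> n)"
  by (induction n) (simp_all add: hook_level_0 hook_level_Suc finite_add_hook)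

lemma F_refl: "F t \<mu> \<mu> = 1"
  by (subst F.simps) simp

lemma F_Suc:
  assumes "0 < t" "\<nu> \<in> hook_level t \<mu> (Suc n)"
  shows "F t \<nu> \<mu> = (\<Sum>\<rho> | \<rho> \<in> hook_level t \<mu> n \<and> add_hook t \<rho> \<nu>. F t \<rho> \<mu>)"
proof -
  have "\<nu> \<noteq> \<mu>"
    using assms by (auto simp: hook_level_def)
  moreover have "{\<rho>. 0 < t \<and> hook_ge t \<nu> \<rho> \<and> hook_ge t \<rho> \<mu> \<and> psize \<nu> = psize \<rho> + t} =
      {\<rho> \<in> hook_level t \<mu> n. add_hook t \<rho> \<nu>}"
    using assms hook_ge_psize_iff[OF assms(1), of \<nu>] by (auto simp: hook_level_def)
  ultimately show ?thesis
    by (subst F.simps) simp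
qed

definition level_sum :: "nat \<Rightarrow> int_partition \<Rightarrow> (int_partition \<Rightarrow> rat) \<Rightarrow> nat \<Rightarrow> rat" where
  "level_sum t \<mu> g n = (\<Sum>\<nu>\<in>hook_level t \<mu> n. of_nat (F t \<nu> \<mu>) * g \<nu>)"

text \<open>By the recursion for \<open>F\<close>, summing over the next level amounts to summing
  over all ways to add a hook at the present one, and the inner sum is
  \<open>g + D t g\<close>.\<close>

lemma level_sum_Suc:
  assumes t: "0 < t"
  shows "level_sum t \<mu> g (Suc n) = level_sum t \<mu> g n + level_sum t \<mu> (D t g) n"
proof -
  let ?L = "hook_level t \<mu>"
  have "level_sum t \<mu> g (Suc n) =
      (\<Sum>\<nu>\<in>?L (Suc n). \<Sum>\<rho> | \<rho> \<in> ?L n \<and> add_hook t \<rho> \<nu>. of_nat (F t \<rho> \<mu>) * g \<nu>)"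
    unfolding level_sum_def by (rule sum.cong) (simp_all add: F_Suc[OF t] sum_distrib_right)
  also have "\<dots> = (\<Sum>\<rho>\<in>?L n. \<Sum>\<nu> | \<nu> \<in> ?L (Suc n) \<and> add_hook t \<rho> \<nu>. of_nat (F t \<rho> \<mu>) * g \<nu>)"
    by (rule sum.swap_restrict) (simp_all add: finite_hook_level[OF t])
  also have "\<dots> = (\<Sum>\<rho>\<in>?L n. of_nat (F t \<rho> \<mu>) * (g \<rho> + D t g \<rho>))"
  proof (rule sum.cong)
    fix \<rho> assume "\<rho> \<in> ?L n"
    then have "{\<nu>. \<nu> \<in> ?L (Suc n) \<and> add_hook t \<rho> \<nu>} = {\<nu>. add_hook t \<rho> \<nu>}"
      by (auto simp: hook_level_Suc[OF t])
    then show "(\<Sum>\<nu> | \<nu> \<in> ?L (Suc n) \<and> add_hook t \<rho> \<nu>. of_nat (F t \<rho> \<mu>) * g \<nu>) =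
        of_nat (F t \<rho> \<mu>) * (g \<rho> + D t g \<rho>)"
      by (simp add: D_def sum_distrib_left)
  qed simp
  also have "\<dots> = level_sum t \<mu> g n + level_sum t \<mu> (D t g) n"
    by (simp add: level_sum_def distrib_left sum.distrib)
  finally show ?thesis .
qed

lemma level_sum_binomial:
  assumes t: "0 < t"
  shows "level_sum t \<mu> g n = (\<Sum>k\<le>n. of_nat (n choose k) * (D t ^^ k) g \<mu>)"
proof (induction n arbitrary: g)
  case 0
  then show ?case
    by (simp add: level_sum_def hook_level_0[OF t] F_refl)
next
  case (Suc n)
  \<comment> \<open>Pascal's rule splits the expansion into those for \<open>g\<close> and for
    \<open>D t g\<close> at level \<open>n\<close>.\<close>
  have "(\<Sum>k\<le>Suc n. of_nat (Suc n choose k) * (D t ^^ k) g \<mu>) =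
      g \<mu> + (\<Sum>k\<le>n. of_nat (n choose Suc k) * (D t ^^ Suc k) g \<mu>) +
      (\<Sum>k\<le>n. of_nat (n choose k) * (D t ^^ Suc k) g \<mu>)"
    by (subst sum.atMost_Suc_shift) (simp add: algebra_simps sum.distrib)
  also have "g \<mu> + (\<Sum>k\<le>n. of_nat (n choose Suc k) * (D t ^^ Suc k) g \<mu>) =
      (\<Sum>k\<le>Suc n. of_nat (n choose k) * (D t ^^ k) g \<mu>)"
    by (subst sum.atMost_Suc_shift) simp
  also have "\<dots> = level_sum t \<mu> g n"
    by (simp add: Suc.IH)
  also have "(\<Sum>k\<le>n. of_nat (n choose k) * (D t ^^ Suc k) g \<mu>) = level_sum t \<mu> (D t g) n"
    unfolding Suc.IH funpow_Suc_right by simp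
  finally show ?case
    by (simp add: level_sum_Suc[OF t])
qed

lemma binomial_poly: "\<exists>p :: rat poly. \<forall>n :: nat. poly p (of_nat n) = of_nat (n choose k)"
proof -
  have "poly (smult (1 / fact k) (\<Prod>i<k. [:- of_nat i, 1:])) (rat_of_nat n) = of_nat (n choose k)" for n
    unfolding binomial_gbinomial gbinomial_prod_rev
    by (simp add: poly_prod lessThan_atLeast0)
  then show ?thesis
    by blast
qed

text \<open>Only the terms \<open>k < r\<close> of the binomial expansion survive, each a polynomial
  in \<open>n\<close>.\<close>

lemma level_sum_poly:
  assumes t: "0 < t" and r: "(D t ^^ r) g = (\<lambda>_. 0)"
  shows "\<exists>p :: rat poly. \<forall>n :: nat. level_sum t \<mu> g n = poly p (of_nat n)"
proof -
  have zero: "(D t ^^ k) g = (\<lambda>_. 0)" if "r \<le> k" for k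
  proof -
    have "(D t ^^ k) g = (D t ^^ (k - r)) ((D t ^^ r) g)"
      using that by (simp flip: comp_apply[of "D t ^^ _"] funpow_add)
    then show ?thesis
      by (simp add: r D_zero)
  qed
  obtain b where b: "\<And>k n. poly (b k) (rat_of_nat n) = of_nat (n choose k)"
    using binomial_poly by metis
  have "level_sum t \<mu> g n = poly (\<Sum>k<r. smult ((D t ^^ k) g \<mu>) (b k)) (of_nat n)" for n
  proof -
    \<comment> \<open>The upper limit \<open>n\<close> is replaced by the fixed \<open>r\<close>:
      terms with \<open>k \<ge> r\<close> vanish by nilpotency, and terms with \<open>k > n\<close>
      have binomial coefficient 0.\<close>
    have "(\<Sum>k\<le>n. of_nat (n choose k) * (D t ^^ k) g \<mu>) =
        (\<Sum>k\<in>{..n} \<inter> {..<r}. of_nat (n choose k) * (D t ^^ k) g \<mu>)"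
    proof (rule sum.mono_neutral_right)
      show "\<forall>k\<in>{..n} - {..n} \<inter> {..<r}. of_nat (n choose k) * (D t ^^ k) g \<mu> = 0"
        by (simp add: zero not_less)
    qed auto
    also have "\<dots> = (\<Sum>k<r. of_nat (n choose k) * (D t ^^ k) g \<mu>)"
      by (rule sum.mono_neutral_left) auto
    finally show ?thesis
      by (simp add: level_sum_binomial[OF t] poly_sum b mult.commute)
  qed
  then show ?thesis
    by blast
qed

theorem theorem1p3:
  fixes t u' v' :: nat
    and j k j' k' :: "nat \<Rightarrow> nat"
    and \<mu> :: int_partition
    and g :: "int_partition \<Rightarrow> rat"
  assumes "0 < t"
    and "is_core t \<mu>"
    and "\<And>\<nu>. g \<nu> = G t \<nu>
      * (\<Prod>u = 1..u'. \<Sum>b | b \<in> boxes \<nu> \<and>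
            ([int (hook_length \<nu> b) = int (j u)] (mod int t) \<or>
             [int (hook_length \<nu> b) = - int (j u)] (mod int t)).
           of_nat (hook_length \<nu> b) ^ (2 * k u))
      * (\<Prod>v = 1..v'. \<Sum>b | b \<in> boxes \<nu> \<and> [box_content b = int (j' v)] (mod int t).
           of_int (box_content b) ^ k' v)"
  shows "(\<exists>r. \<forall>\<nu>. core_of t \<nu> = \<mu> \<longrightarrow> (D t ^^ r) g \<nu> = 0) \<and>
    (\<exists>p :: rat poly. \<forall>n :: nat.
       (\<Sum>\<nu> | core_of t \<nu> = \<mu> \<and> int (psize \<nu>) - int (psize \<mu>) = int (n * t).
          of_nat (F t \<nu> \<mu>) * g \<nu>) = poly p (of_nat n))"
proof
  define q where "q \<nu> = (\<Prod>u = 1..u'. \<Sum>b | b \<in> boxes \<nu> \<and>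
            ([int (hook_length \<nu> b) = int (j u)] (mod int t) \<or>
             [int (hook_length \<nu> b) = - int (j u)] (mod int t)).
           of_nat (hook_length \<nu> b) ^ (2 * k u))
      * (\<Prod>v = 1..v'. \<Sum>b | b \<in> boxes \<nu> \<and> [box_content b = int (j' v)] (mod int t).
           rat_of_int (box_content b) ^ k' v)" for \<nu>
  have "hook_poly t q"
    unfolding q_def[abs_def]
    by (intro hook_poly_mult hook_poly_prod hook_poly_hook_class_sum hook_poly_content_class_sum \<open>0 < t\<close>)
  then obtain w where "hook_filt t w q"
    by (auto simp: hook_poly_def)
  moreover have g: "g = (\<lambda>\<nu>. G t \<nu> * q \<nu>)"
    using assms(3) by (simp add: q_def fun_eq_iff mult.assoc)
  \<comment> \<open>Enough since \<open>w < 2 * Suc w\<close>. The function vanishes at all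
    partitions, so the same exponent serves every core.\<close>
  ultimately have r: "(D t ^^ Suc w) g = (\<lambda>_. 0)"
    using D_nilpotent[OF \<open>0 < t\<close>, of w q "Suc w"] by simp
  then show "\<exists>r. \<forall>\<nu>. core_of t \<nu> = \<mu> \<longrightarrow> (D t ^^ r) g \<nu> = 0"
    by metis
  have "{\<nu>. core_of t \<nu> = \<mu> \<and> int (psize \<nu>) - int (psize \<mu>) = int (n * t)} = hook_level t \<mu> n" for n
  proof -
    have "int (psize \<nu>) - int (psize \<mu>) = int (n * t) \<longleftrightarrow> psize \<nu> = psize \<mu> + n * t" for \<nu>
      by (simp only: diff_eq_eq flip: of_nat_add of_nat_eq_iff[where 'a = int]) (simp add: add.commute)
    then show ?thesis
      unfolding core_of_eq_iff[OF assms(1,2)] hook_level_def by simp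
  qed
  then show "\<exists>p :: rat poly. \<forall>n :: nat.
       (\<Sum>\<nu> | core_of t \<nu> = \<mu> \<and> int (psize \<nu>) - int (psize \<mu>) = int (n * t).
          of_nat (F t \<nu> \<mu>) * g \<nu>) = poly p (of_nat n)"
    using level_sum_poly[OF assms(1) r, of \<mu>] by (simp add: level_sum_def)
qed

end
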